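(* Let $(X,d_X)$ be a proper, non-compact $\mathrm{CAT}(-1)$ space. For each choice of base point $(o,o')\in X\times X$ the map $$\varphi_{\mathrm{reg}}:\partial_\infty^{\max}(X\times X)_{\mathrm{reg}}\longrightarrow\partial_\infty X\times\partial_\infty X\times\mathbb{R},\qquad \left[\max\{\beta_\xi^{p}(z),\beta_{\xi'}^{p'}(z')\}\right]\mapsto\bigl(\xi,\xi',\beta_{\xi'}^{p'}(o)-\beta_\xi^{p}(o')\bigr)$$ is a (well-defined) homeomorphism.
   Context: $\partial_\infty X$ is the ideal boundary of $X$ (equivalence classes of geodesic rays at bounded distance) with its usual topology. For $\xi\in\partial_\infty X$ and $p\in X$, the Busemann function is $\beta_\xi^p(\cdot)=\lim_{t\to\infty}\bigl(d_X(\cdot,c(t))-t\bigr)$, where $c$ is the ray with $c(0)=p$, $c(\infty)=\xi$. On $X\times X$ consider $d_{\max}((x,y),(x',y'))=\max\{d_X(x,x'),d_X(y,y')\}$. Let $C_*$ be the space of continuous functions $X\times X\to\mathbb{R}$ (with the topology of uniform convergence on compact sets) modulo additive constants, and embed $X\times X$ in $C_*$ by $\iota(x,y)=[d_{\max}((x,y),\cdot)]$. Then $\overline{X\times X}^{\max}$ is the closure of $\iota(X\times X)$ in $C_*$ and $\partial_\infty^{\max}(X\times X)=\overline{X\times X}^{\max}\setminus\iota(X\times X)$. The regular part $\partial_\infty^{\max}(X\times X)_{\mathrm{reg}}$ (with the subspace topology) is the set of boundary points that are classes modulo constants of functions $(z,z')\mapsto\max\{\beta^{p}_{\xi}(z),\beta^{p'}_{\xi'}(z')\}$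 with $p,p'\in X$ and $\xi,\xi'\in\partial_\infty X$. *)

theory Defs
  imports "HOL-Analysis.Analysis"
begin

section \<open>The hyperbolic plane and CAT(-1) spaces\<close>

text \<open>Hyperboloid model: the sheet \<open>t > 0\<close> of \<open>t\<^sup>2 - |z|\<^sup>2 = 1\<close> in
  \<open>\<real> \<times> \<complex> = \<real>\<^sup>1\<^sup>+\<^sup>2\<close>, with \<open>cosh d\<close> equal to minus the Lorentz form.\<close>

definition hyp_plane :: "(real \<times> complex) set" where
  "hyp_plane = {(t, z). t > 0 \<and> t\<^sup>2 - (norm z)\<^sup>2 = 1}"

definition hyp_dist :: "real \<times> complex \<Rightarrow> real \<times> complex \<Rightarrow> real" where
  "hyp_dist u v = arcosh (fst u * fst v - snd u \<bullet> snd v)"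

definition geodesic_segment :: "'a::metric_space set \<Rightarrow> 'a \<Rightarrow> 'a \<Rightarrow> 'a set \<Rightarrow> bool" where
  "geodesic_segment S x y G \<longleftrightarrow>
     (\<exists>c l. 0 \<le> l \<and> (\<forall>s\<in>{0..l}. \<forall>t\<in>{0..l}. dist (c s) (c t) = \<bar>s - t\<bar>) \<and>
            c 0 = x \<and> c l = y \<and> G = c ` {0..l} \<and> G \<subseteq> S)"

text \<open>The pairs of a point of the side \<open>G\<close> from \<open>p\<close> to \<open>q\<close> and its comparison point on the
  hyperbolic segment from \<open>p'\<close> to \<open>q'\<close>; as \<open>dist p x + dist x q = dist p q\<close> on a geodesic,
  the two distances place the comparison point on that segment.\<close>

definition comparison_points ::
  "'a::metric_space \<Rightarrow> 'a \<Rightarrow> 'a set \<Rightarrow> real \<times> complex \<Rightarrow> real \<times> complex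
     \<Rightarrow> ('a \<times> (real \<times> complex)) set" where
  "comparison_points p q G p' q' =
     {(x, x'). x \<in> G \<and> x' \<in> hyp_plane \<and>
               hyp_dist p' x' = dist p x \<and> hyp_dist x' q' = dist x q}"

definition CAT_neg1 :: "'a::metric_space set \<Rightarrow> bool" where
  "CAT_neg1 S \<longleftrightarrow>
     (\<forall>x\<in>S. \<forall>y\<in>S. \<exists>G. geodesic_segment S x y G) \<and>
     (\<forall>p q r A B C.
        geodesic_segment S p q A \<and> geodesic_segment S q r B \<and> geodesic_segment S r p C \<longrightarrow>
        (\<forall>p'\<in>hyp_plane. \<forall>q'\<in>hyp_plane. \<forall>r'\<in>hyp_plane.
           hyp_dist p' q' = dist p q \<and> hyp_dist q' r' = dist q r \<and> hyp_dist r' p' = dist r p \<longrightarrow>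
           (\<forall>(x, x') \<in> comparison_points p q A p' q' \<union> comparison_points q r B q' r'
                        \<union> comparison_points r p C r' p'.
            \<forall>(y, y') \<in> comparison_points p q A p' q' \<union> comparison_points q r B q' r'
                        \<union> comparison_points r p C r' p'.
              dist x y \<le> hyp_dist x' y')))"


section \<open>The ideal boundary and Busemann functions\<close>

text \<open>Rays live on \<open>[0,\<infinity>)\<close>; extensionality makes them determined by their values there.\<close>

definition geodesic_rays :: "(real \<Rightarrow> 'a::metric_space) set" where
  "geodesic_rays = {c \<in> extensional {0..}. \<forall>s\<ge>0. \<forall>t\<ge>0. dist (c s) (c t) = \<bar>s - t\<bar>}"

definition asymptotic :: "((real \<Rightarrow> 'a::metric_space) \<times> (real \<Rightarrow> 'a)) set" where
  "asymptotic = {(c, c'). c \<in> geodesic_rays \<and> c' \<in> geodesic_rays \<and>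
                          (\<exists>K. \<forall>t\<ge>0. dist (c t) (c' t) \<le> K)}"

definition ideal_boundary :: "(real \<Rightarrow> 'a::metric_space) set set" where
  "ideal_boundary = geodesic_rays // asymptotic"

text \<open>Cone topology: the sets \<open>cone_nbhd c r e\<close> with a fixed base point \<open>c 0\<close> form a base of
  it, and for complete CAT(0) spaces it does not depend on that base point, so that allowing all
  base points generates the same topology.\<close>

definition cone_nbhd :: "(real \<Rightarrow> 'a::metric_space) \<Rightarrow> real \<Rightarrow> real \<Rightarrow> (real \<Rightarrow> 'a) set set" where
  "cone_nbhd c r e = {\<xi> \<in> ideal_boundary. \<exists>c'\<in>\<xi>. c' 0 = c 0 \<and> dist (c' r) (c r) < e}"

definition ideal_boundary_topology :: "(real \<Rightarrow> 'a::metric_space) set topology" where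
  "ideal_boundary_topology =
     topology_generated_by {cone_nbhd c r e | c r e. c \<in> geodesic_rays \<and> 0 < r \<and> 0 < e}"

definition ray_from :: "'a::metric_space \<Rightarrow> (real \<Rightarrow> 'a) set \<Rightarrow> real \<Rightarrow> 'a" where
  "ray_from p \<xi> = (THE c. c \<in> \<xi> \<and> c 0 = p)"

definition busemann :: "(real \<Rightarrow> 'a::metric_space) set \<Rightarrow> 'a \<Rightarrow> 'a \<Rightarrow> real" where
  "busemann \<xi> p z = Lim at_top (\<lambda>t. dist z (ray_from p \<xi> t) - t)"


section \<open>Continuous functions modulo constants\<close>

definition continuous_functions :: "('b::topological_space \<Rightarrow> real) set" where
  "continuous_functions = {f. continuous_on UNIV f}"

definition compact_convergence_topology :: "('b::topological_space \<Rightarrow> real) topology" where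
  "compact_convergence_topology = topology_generated_by
     {{g \<in> continuous_functions. \<forall>x\<in>K. \<bar>g x - f x\<bar> < e} | f K e.
        f \<in> continuous_functions \<and> compact K \<and> 0 < e}"

definition quotient_topology :: "'b topology \<Rightarrow> ('b \<Rightarrow> 'c) \<Rightarrow> 'c topology" where
  "quotient_topology T f =
     topology (\<lambda>U. U \<subseteq> f ` topspace T \<and> openin T {x \<in> topspace T. f x \<in> U})"

lemma openin_quotient_topology:
  "openin (quotient_topology T f) U \<longleftrightarrow>
     U \<subseteq> f ` topspace T \<and> openin T {x \<in> topspace T. f x \<in> U}"
proof -
  have "istopology (\<lambda>U. U \<subseteq> f ` topspace T \<and> openin T {x \<in> topspace T. f x \<in> U})"
    unfolding istopology_def
  proof (intro conjI allI impI, goal_cases)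
    case (2 S U)
    have "{x \<in> topspace T. f x \<in> S \<inter> U} =
        {x \<in> topspace T. f x \<in> S} \<inter> {x \<in> topspace T. f x \<in> U}" by auto
    with 2 show ?case by (simp add: openin_Int)
  next
    case (4 \<K>)
    have "{x \<in> topspace T. f x \<in> \<Union>\<K>} = (\<Union>S\<in>\<K>. {x \<in> topspace T. f x \<in> S})" by auto
    with 4 show ?case by auto
  qed auto
  then show ?thesis
    by (simp add: quotient_topology_def topology_inverse')
qed

lemma quotient_map_quotient_topology: "quotient_map T (quotient_topology T f) f"
proof -
  have "{x \<in> topspace T. f x \<in> f ` topspace T} = topspace T" by auto
  then have "openin (quotient_topology T f) (f ` topspace T)"
    by (simp add: openin_quotient_topology)
  then have "topspace (quotient_topology T f) = f ` topspace T"
    by (metis openin_quotient_topology openin_subset openin_topspace subset_antisym)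
  then show ?thesis
    by (auto simp: quotient_map_def openin_quotient_topology)
qed

definition differ_by_const :: "(('b::topological_space \<Rightarrow> real) \<times> ('b \<Rightarrow> real)) set" where
  "differ_by_const = {(f, g). f \<in> continuous_functions \<and> g \<in> continuous_functions \<and>
                              (\<exists>k. \<forall>x. g x = f x + k)}"

definition const_class :: "('b::topological_space \<Rightarrow> real) \<Rightarrow> ('b \<Rightarrow> real) set" where
  "const_class f = differ_by_const `` {f}"

definition C_star :: "('b::topological_space \<Rightarrow> real) set topology" where
  "C_star = quotient_topology compact_convergence_topology const_class"


section \<open>The boundary for the maximum metric\<close>

definition dmax :: "'a::metric_space \<times> 'a \<Rightarrow> 'a \<times> 'a \<Rightarrow> real" where
  "dmax u v = max (dist (fst u) (fst v)) (dist (snd u) (snd v))"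

definition iota_max :: "'a::metric_space \<times> 'a \<Rightarrow> ('a \<times> 'a \<Rightarrow> real) set" where
  "iota_max u = const_class (dmax u)"

definition max_compactification :: "('a::metric_space \<times> 'a \<Rightarrow> real) set set" where
  "max_compactification = C_star closure_of (range iota_max)"

definition max_boundary :: "('a::metric_space \<times> 'a \<Rightarrow> real) set set" where
  "max_boundary = max_compactification - range iota_max"

definition max_busemann_class ::
  "(real \<Rightarrow> 'a::metric_space) set \<Rightarrow> 'a \<Rightarrow> (real \<Rightarrow> 'a) set \<Rightarrow> 'a \<Rightarrow> ('a \<times> 'a \<Rightarrow> real) set" where
  "max_busemann_class \<xi> p \<xi>' p' =
     const_class (\<lambda>(z, z'). max (busemann \<xi> p z) (busemann \<xi>' p' z'))"

definition max_boundary_reg :: "('a::metric_space \<times> 'a \<Rightarrow> real) set set" where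
  "max_boundary_reg =
     {F \<in> max_boundary. \<exists>p p'. \<exists>\<xi>\<in>ideal_boundary. \<exists>\<xi>'\<in>ideal_boundary.
        F = max_busemann_class \<xi> p \<xi>' p'}"

end

theory Submission
  imports Defs
begin

text \<open>
  Everything metric comes from one consequence of the CAT(-1) condition,
  \<open>CAT_neg1_cosh_convex\<close>: along a geodesic \<open>c\<close> of length \<open>l\<close>, \<open>cosh (dist p (c s))\<close> lies below
  the solution of \<open>f'' = f\<close> with the same values at the ends. It is stable under limits. Letting
  \<open>p\<close> escape along a ray replaces \<open>cosh (dist p z)\<close> by the exponential of the Busemann function of the
  ray; letting the end of \<open>c\<close> escape bounds the distance to a ray in terms of its Busemann function.
  Four facts follow.

  \<^item> A ball of radius \<open>r\<close> about \<open>p\<close> contains exactly one point where the Busemann function of a ray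
    has dropped by \<open>r\<close>, and points where it has dropped by almost \<open>r\<close> are close to it
    (\<open>horoball_points_close\<close>). The rays asymptotic to the given one are the curves of these points, so
    every point starts exactly one of them (\<open>asymptotic_ray_exists\<close>, \<open>asymptotic_ray_unique\<close>).
  \<^item> Busemann functions of asymptotic rays differ by a constant (\<open>ray_busemann_asymptotic\<close>).
  \<^item> The limit that defines the Busemann function is uniform over bounded sets and over all rays from
    one point (\<open>dist_ray_le_ray_busemann\<close>), so Busemann functions depend continuously on the ideal
    point.
  \<^item> Conversely, if two Busemann functions almost agree up to a constant on a ball about \<open>x\<close>, then the
    rays from \<open>x\<close> to their ideal points stay close within this ball (\<open>ray_from_close\<close>).

  The maximum \<open>F (z, z') = max (f z) (f' z')\<close> of two Busemann functions determines both of them: to read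
  off \<open>f\<close> near a point, evaluate \<open>F\<close> with \<open>z'\<close> so far out on the ray of \<open>f'\<close> that \<open>f'\<close> cannot be the
  larger one. The same holds with a constant and an error, since the value of \<open>F\<close> far out on both rays
  bounds both functions from above there (\<open>max_isolates_left\<close>, \<open>max_busemann_separates\<close>). Hence a class
  determines both ideal points, and the common additive constant cancels in the third
  coordinate; with an error the same argument gives continuity of the coordinates. The inverse sends
  \<open>(\<xi>, \<xi>', r)\<close> to the class of \<open>max (\<beta>\<^sub>\<xi> z) (\<beta>\<^sub>\<xi>\<^sub>' z' + r)\<close>, where \<open>\<beta>\<^sub>\<xi>\<close> vanishes at \<open>b'\<close> and
  \<open>\<beta>\<^sub>\<xi>\<^sub>'\<close> vanishes at \<open>b\<close>. Moving a base point along its ray shifts the Busemann function by any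
  amount of one sign, and only the difference of the two shifts matters for the class, so every \<open>r\<close>
  arises. Finally all these classes are boundary points: they are limits of the points with both
  components at time \<open>t\<close> on the two rays, and they are unbounded below, unlike a distance function.
\<close>

section \<open>Convexity of distance in CAT(-1) spaces\<close>

definition geodesic_path :: "(real \<Rightarrow> 'a::metric_space) \<Rightarrow> real \<Rightarrow> bool" where
  "geodesic_path c l \<longleftrightarrow> 0 \<le> l \<and> (\<forall>s\<in>{0..l}. \<forall>t\<in>{0..l}. dist (c s) (c t) = \<bar>s - t\<bar>)"

lemma geodesic_pathD:
  "geodesic_path c l \<Longrightarrow> 0 \<le> s \<Longrightarrow> s \<le> l \<Longrightarrow> 0 \<le> t \<Longrightarrow> t \<le> l \<Longrightarrow> dist (c s) (c t) = \<bar>s - t\<bar>"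
  by (simp add: geodesic_path_def)

lemma geodesic_segment_image:
  assumes "geodesic_path c l"
  shows "geodesic_segment UNIV (c 0) (c l) (c ` {0..l})"
  using assms unfolding geodesic_path_def geodesic_segment_def by blast

text \<open>By the triangle inequalities there is a hyperbolic triangle with sides \<open>l\<close>, \<open>A\<close>, \<open>B\<close>: with the side
  \<open>l\<close> on the first axis and one end of it at the origin, \<open>(u, v)\<close> are the spatial coordinates of the
  opposite vertex in the hyperboloid model. Solving the law of cosines for \<open>u\<close>, and not for the angle,
  covers the degenerate case \<open>A = 0\<close>.\<close>

lemma hyperbolic_triangle_exists:
  fixes A B l :: real
  assumes "0 \<le> A" "0 \<le> B" "0 < l" "\<bar>l - A\<bar> \<le> B" "B \<le> l + A"
  obtains u v where "\<bar>u\<bar> \<le> sinh A" "u\<^sup>2 + v\<^sup>2 = (sinh A)\<^sup>2"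
    "sinh l * u = cosh l * cosh A - cosh B"
proof -
  define u where "u = (cosh l * cosh A - cosh B) / sinh l"
  have sl: "0 < sinh l" using assms by simp
  have "cosh (l - A) \<le> cosh B"
    using cosh_real_nonneg_le_iff[of "\<bar>l - A\<bar>" B] assms by simp
  moreover have "cosh B \<le> cosh (l + A)"
    using cosh_real_nonneg_le_iff[of B "l + A"] assms by simp
  ultimately have "\<bar>cosh l * cosh A - cosh B\<bar> \<le> sinh l * sinh A"
    by (simp add: cosh_add cosh_diff abs_le_iff)
  then have u: "\<bar>u\<bar> \<le> sinh A"
    using sl by (simp add: u_def abs_divide field_simps)
  then have "u\<^sup>2 \<le> (sinh A)\<^sup>2"
    using power_mono[of "\<bar>u\<bar>" "sinh A" 2] by simp
  then have "u\<^sup>2 + (sqrt ((sinh A)\<^sup>2 - u\<^sup>2))\<^sup>2 = (sinh A)\<^sup>2" by simp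
  with u sl show thesis by (intro that[of u]) (auto simp: u_def)
qed

text \<open>Of the CAT(-1) condition only comparisons between a point of one side and the opposite vertex
  matter; in the hyperbolic plane the inequality is an equality, the hyperbolic Stewart theorem.\<close>

lemma CAT_neg1_cosh_convex:
  fixes p :: "'a::metric_space"
  assumes cat: "CAT_neg1 (UNIV :: 'a set)" and geo: "geodesic_path c l" and s: "0 \<le> s" "s \<le> l"
  shows "sinh l * cosh (dist p (c s))
    \<le> sinh (l - s) * cosh (dist p (c 0)) + sinh s * cosh (dist p (c l))"
proof (cases "l = 0")
  case True
  with s show ?thesis by simp
next
  case False
  with s have l: "0 < l" by simp
  define A where "A = dist p (c 0)"
  define B where "B = dist p (c l)"
  have d: "dist (c x) (c y) = \<bar>x - y\<bar>" if "0 \<le> x" "x \<le> l" "0 \<le> y" "y \<le> l" for x y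
    using geo that by (auto simp: geodesic_path_def)
  have tri: "0 \<le> A" "0 \<le> B" "\<bar>l - A\<bar> \<le> B" "B \<le> l + A"
    using d[of 0 l] l dist_triangle[of "c 0" "c l" p] dist_triangle[of p "c 0" "c l"]
      dist_triangle[of p "c l" "c 0"]
    by (auto simp: A_def B_def dist_commute abs_le_iff)
  obtain u v where uv: "\<bar>u\<bar> \<le> sinh A" "u\<^sup>2 + v\<^sup>2 = (sinh A)\<^sup>2"
      "sinh l * u = cosh l * cosh A - cosh B"
    using hyperbolic_triangle_exists[OF tri(1,2) l tri(3,4)] .
  define V where "V = cosh s * cosh A - sinh s * u"
  have "cosh (s - A) \<le> V"
    unfolding V_def cosh_diff using uv(1) s
    by (smt (verit, best) mult_left_mono sinh_real_nonneg_iff)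
  then have V: "1 \<le> V" using cosh_real_ge_1[of "s - A"] by simp
  \<comment> \<open>The comparison triangle \<open>P\<close>, \<open>Q\<close>, \<open>R\<close> of \<open>c 0\<close>, \<open>c l\<close>, \<open>p\<close>; the point \<open>Y\<close> corresponds to \<open>c s\<close>.\<close>
  define P where "P = (1::real, 0::complex)"
  define Q where "Q = (cosh l, Complex (sinh l) 0)"
  define Y where "Y = (cosh s, Complex (sinh s) 0)"
  define R where "R = (cosh A, Complex u v)"
  have H: "P \<in> hyp_plane" "Q \<in> hyp_plane" "Y \<in> hyp_plane" "R \<in> hyp_plane"
    using uv(2) by (auto simp: hyp_plane_def P_def Q_def Y_def R_def cmod_def cosh_square_eq)
  have D: "hyp_dist P Q = l" "hyp_dist Q R = B" "hyp_dist R P = A"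
      "hyp_dist P Y = s" "hyp_dist Y Q = l - s" "hyp_dist R R = 0" "hyp_dist Y R = arcosh V"
    using uv(2,3) l s tri(1,2) arcosh_cosh_real[of "l - s"] hyperbolic_pythagoras[of A]
    by (simp_all add: hyp_dist_def P_def Q_def R_def Y_def V_def inner_complex_def
        arcosh_cosh_real cosh_diff mult.commute power2_eq_square)
  obtain G1 G2 where G: "geodesic_segment UNIV (c l) p G1" "geodesic_segment UNIV p (c 0) G2"
    using cat[unfolded CAT_neg1_def, THEN conjunct1, rule_format, OF UNIV_I UNIV_I] by metis
  have pG: "p \<in> G1" using G(1) by (auto simp: geodesic_segment_def)
  note conv = cat[unfolded CAT_neg1_def, THEN conjunct2, rule_format,
      OF conjI[OF geodesic_segment_image[OF geo] conjI[OF G]] H(1,2,4)]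
  have sides: "hyp_dist P Q = dist (c 0) (c l) \<and> hyp_dist Q R = dist (c l) p
      \<and> hyp_dist R P = dist p (c 0)"
    using D d[of 0 l] l by (simp add: A_def B_def dist_commute)
  have Y: "(c s, Y) \<in> comparison_points (c 0) (c l) (c ` {0..l}) P Q"
    using H(3) D d[of 0 s] d[of s l] s by (auto simp: comparison_points_def)
  have R: "(p, R) \<in> comparison_points (c l) p G1 Q R"
    using H(4) D pG by (auto simp: comparison_points_def B_def dist_commute)
  have "case (p, R) of (y, y') \<Rightarrow> dist (c s) y \<le> hyp_dist Y y'"
    by (rule bspec[OF conv[OF sides UnI1[OF UnI1[OF Y]], unfolded prod.case] UnI1[OF UnI2[OF R]]])
  then have "dist (c s) p \<le> hyp_dist Y R" by simp
  then have "cosh (dist p (c s)) \<le> cosh (arcosh V)"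
    using cosh_real_nonneg_le_iff[of "dist p (c s)" "arcosh V"] V D(7)
    by (simp add: dist_commute)
  then have "sinh l * cosh (dist p (c s)) \<le> sinh l * V"
    using V l by (intro mult_left_mono) auto
  also have "sinh l * V = sinh l * cosh s * cosh A - sinh s * (sinh l * u)"
    by (simp add: V_def algebra_simps)
  also have "\<dots> = sinh (l - s) * cosh A + sinh s * cosh B"
    unfolding uv(3) sinh_diff by (simp add: algebra_simps)
  finally show ?thesis by (simp add: A_def B_def)
qed

lemma CAT_neg1_geodesic:
  fixes x y :: "'a::metric_space"
  assumes "CAT_neg1 (UNIV :: 'a set)"
  obtains c where "geodesic_path c (dist x y)" "c 0 = x" "c (dist x y) = y"
proof -
  from assms obtain G where "geodesic_segment UNIV x y G" unfolding CAT_neg1_def by blast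
  then obtain c l where cl: "geodesic_path c l" "c 0 = x" "c l = y"
    by (auto simp: geodesic_segment_def geodesic_path_def)
  then have "dist x y = l" by (force simp: geodesic_path_def)
  with cl show thesis using that by blast
qed

lemma CAT_neg1_midpoint:
  fixes x y :: "'a::metric_space"
  assumes cat: "CAT_neg1 (UNIV :: 'a set)"
  obtains m where "\<And>p. 2 * cosh (dist x y / 2) * cosh (dist p m) \<le> cosh (dist p x) + cosh (dist p y)"
proof -
  obtain c where c: "geodesic_path c (dist x y)" "c 0 = x" "c (dist x y) = y"
    using CAT_neg1_geodesic[OF cat] .
  define h where "h = dist x y / 2"
  have "2 * cosh h * cosh (dist p (c h)) \<le> cosh (dist p x) + cosh (dist p y)" for p
  proof (cases "h = 0")
    case True
    then show ?thesis using c(2) by (simp add: h_def)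
  next
    case False
    then have h: "0 < sinh h" by (simp add: h_def)
    have "sinh (2 * h) * cosh (dist p (c h)) \<le> sinh h * (cosh (dist p x) + cosh (dist p y))"
      using CAT_neg1_cosh_convex[OF cat c(1), of h p] c(2,3)
      by (simp add: h_def algebra_simps)
    then have "sinh h * (2 * cosh h * cosh (dist p (c h)))
        \<le> sinh h * (cosh (dist p x) + cosh (dist p y))"
      unfolding sinh_double by (simp add: mult_ac)
    with h show ?thesis by simp
  qed
  then show thesis unfolding h_def by (rule that)
qed

section \<open>Geodesic rays and Busemann functions\<close>

text \<open>Busemann functions of explicit rays: that an ideal point has a ray from each base point, on which
  \<open>busemann\<close> relies, is itself derived from them.\<close>

definition ray_busemann :: "(real \<Rightarrow> 'a::metric_space) \<Rightarrow> 'a \<Rightarrow> real" where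
  "ray_busemann c z = Lim at_top (\<lambda>t. dist z (c t) - t)"

lemma geodesic_rayD: "c \<in> geodesic_rays \<Longrightarrow> 0 \<le> s \<Longrightarrow> 0 \<le> t \<Longrightarrow> dist (c s) (c t) = \<bar>s - t\<bar>"
  by (simp add: geodesic_rays_def)

lemma geodesic_ray_path: "c \<in> geodesic_rays \<Longrightarrow> 0 \<le> l \<Longrightarrow> geodesic_path c l"
  by (simp add: geodesic_path_def geodesic_rayD)

text \<open>The function under the limit decreases in \<open>t\<close> and is bounded below, by the triangle inequality.\<close>

lemma tendsto_Inf_dist_ray:
  assumes c: "c \<in> geodesic_rays"
  shows "((\<lambda>t. dist z (c t) - t) \<longlongrightarrow> Inf ((\<lambda>t. dist z (c t) - t) ` {0..})) at_top"
    and "bdd_below ((\<lambda>t. dist z (c t) - t) ` {0..})"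
proof -
  let ?f = "\<lambda>t. dist z (c t) - t"
  have mono: "?f t \<le> ?f s" if "0 \<le> s" "s \<le> t" for s t
    using dist_triangle[of z "c t" "c s"] geodesic_rayD[OF c, of s t] that by simp
  have "- dist z (c 0) \<le> ?f t" if "0 \<le> t" for t
    using dist_triangle[of "c 0" "c t" z] geodesic_rayD[OF c, of 0 t] that by (simp add: dist_commute)
  then show bdd: "bdd_below (?f ` {0..})" by (auto intro!: bdd_belowI)
  show "(?f \<longlongrightarrow> Inf (?f ` {0..})) at_top"
  proof (rule decreasing_tendsto)
    show "\<forall>\<^sub>F t in at_top. Inf (?f ` {0..}) \<le> ?f t"
      using eventually_ge_at_top[of 0] by eventually_elim (auto intro!: cInf_lower bdd)
  next
    fix x assume "Inf (?f ` {0..}) < x"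
    then obtain s where s: "0 \<le> s" "?f s < x" using cInf_lessD[of "?f ` {0..}" x] by auto
    show "\<forall>\<^sub>F t in at_top. ?f t < x"
      using eventually_ge_at_top[of s] by eventually_elim (use mono s in force)
  qed
qed

lemma tendsto_ray_busemann:
  assumes "c \<in> geodesic_rays"
  shows "((\<lambda>t. dist z (c t) - t) \<longlongrightarrow> ray_busemann c z) at_top"
  using tendsto_Inf_dist_ray(1)[OF assms, of z]
    tendsto_Lim[OF trivial_limit_at_top_linorder tendsto_Inf_dist_ray(1)[OF assms, of z]]
  by (simp add: ray_busemann_def)

lemma ray_busemann_le:
  assumes c: "c \<in> geodesic_rays" and "0 \<le> t"
  shows "ray_busemann c z \<le> dist z (c t) - t"
proof -
  have "ray_busemann c z = Inf ((\<lambda>t. dist z (c t) - t) ` {0..})"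
    using tendsto_unique[OF _ tendsto_ray_busemann[OF c] tendsto_Inf_dist_ray(1)[OF c]] by simp
  then show ?thesis using tendsto_Inf_dist_ray(2)[OF c, of z] assms(2) by (auto intro!: cInf_lower)
qed

lemma ray_busemann_le_add_dist:
  assumes c: "c \<in> geodesic_rays"
  shows "ray_busemann c x \<le> ray_busemann c y + dist x y"
proof (rule tendsto_le[OF _ _ tendsto_ray_busemann[OF c, of x]])
  show "((\<lambda>t. (dist y (c t) - t) + dist x y) \<longlongrightarrow> ray_busemann c y + dist x y) at_top"
    by (intro tendsto_intros tendsto_ray_busemann c)
  show "\<forall>\<^sub>F t in at_top. dist x (c t) - t \<le> dist y (c t) - t + dist x y"
    by (intro always_eventually allI) (use dist_triangle in \<open>auto simp: algebra_simps\<close>)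
qed simp

lemma ray_busemann_along_ray:
  assumes c: "c \<in> geodesic_rays" and s: "0 \<le> s"
  shows "ray_busemann c (c s) = - s"
proof -
  have "((\<lambda>t. dist (c s) (c t) - t) \<longlongrightarrow> - s) at_top"
    by (rule tendsto_eventually, rule eventually_mono[OF eventually_ge_at_top[of s]])
      (use s geodesic_rayD[OF c] in auto)
  then show ?thesis
    using tendsto_unique[OF _ tendsto_ray_busemann[OF c]] by simp
qed

lemma abs_ray_busemann_le:
  assumes c: "c \<in> geodesic_rays"
  shows "\<bar>ray_busemann c z\<bar> \<le> dist z (c 0)"
  using ray_busemann_le_add_dist[OF c, of z "c 0"] ray_busemann_le_add_dist[OF c, of "c 0" z]
    ray_busemann_along_ray[OF c, of 0] by (simp add: dist_commute abs_le_iff)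

text \<open>The normalising factor \<open>2 exp (-t)\<close> turns \<open>cosh\<close> and \<open>sinh\<close> of a quantity growing like \<open>t + a\<close> into
  something tending to \<open>exp a\<close>; the limits below use it throughout.\<close>

lemma two_exp_cosh: "2 * exp (- t) * cosh d = exp (d - t) + exp (- d - t)" for d t :: real
  by (simp add: cosh_def exp_diff exp_minus field_simps)

lemma two_exp_sinh: "2 * exp (- t) * sinh d = exp (d - t) - exp (- d - t)" for d t :: real
  by (simp add: sinh_def exp_diff exp_minus field_simps)

lemma exp_uminus_at_top: "((\<lambda>t::real. exp (- t)) \<longlongrightarrow> 0) at_top"
  by (rule filterlim_compose[OF exp_at_bot filterlim_uminus_at_bot_at_top])

lemma ex_exp_uminus_less:
  fixes K e :: real
  assumes "0 < e"
  shows "\<exists>t>0. K * exp (- t) < e"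
proof -
  have "((\<lambda>t. K * exp (- t)) \<longlongrightarrow> K * 0) at_top"
    by (rule tendsto_mult_left[OF exp_uminus_at_top])
  then have "\<forall>\<^sub>F t in at_top. K * exp (- t) < e"
    by (rule order_tendstoD(2)) (use assms in simp)
  then have "\<forall>\<^sub>F t in at_top. K * exp (- t) < e \<and> 0 < t"
    using eventually_gt_at_top by (rule eventually_conj)
  then show ?thesis using eventually_happens'[OF trivial_limit_at_top_linorder] by blast
qed

lemma tendsto_exp_sinh: "((\<lambda>t::real. 2 * exp (- t) * sinh (t - s)) \<longlongrightarrow> exp (- s)) at_top"
proof -
  have "2 * exp (- t) * sinh (t - s) = exp (- s) - exp s * (exp (- t) * exp (- t))" for t :: real
    by (simp add: two_exp_sinh flip: exp_add)
  moreover have "((\<lambda>t. exp (- s) - exp s * (exp (- t) * exp (- t))) \<longlongrightarrow> exp (- s) - exp s * (0 * 0)) at_top"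
    by (intro tendsto_intros exp_uminus_at_top)
  ultimately show ?thesis by simp
qed

lemma tendsto_exp_cosh: "((\<lambda>t::real. 2 * exp (- t) * cosh t) \<longlongrightarrow> 1) at_top"
proof -
  have "2 * exp (- t) * cosh t = 1 + exp (- t) * exp (- t)" for t :: real
    by (simp add: two_exp_cosh flip: exp_add)
  moreover have "((\<lambda>t::real. 1 + exp (- t) * exp (- t)) \<longlongrightarrow> 1 + 0 * 0) at_top"
    by (intro tendsto_intros exp_uminus_at_top)
  ultimately show ?thesis by simp
qed

lemma tendsto_exp_cosh_dist:
  assumes c: "c \<in> geodesic_rays"
  shows "((\<lambda>t. 2 * exp (- t) * cosh (dist z (c t))) \<longlongrightarrow> exp (ray_busemann c z)) at_top"
proof -
  have "((\<lambda>t. exp (- dist z (c t) - t)) \<longlongrightarrow> 0) at_top"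
    by (rule tendsto_sandwich[OF _ _ tendsto_const exp_uminus_at_top]) auto
  from tendsto_add[OF tendsto_exp[OF tendsto_ray_busemann[OF c]] this]
  show ?thesis by (simp add: two_exp_cosh)
qed

text \<open>This is \<open>CAT_neg1_cosh_convex\<close> with the vertex \<open>p\<close> moved to infinity along \<open>c\<close>.\<close>

lemma exp_ray_busemann_convex:
  fixes c :: "real \<Rightarrow> 'a::metric_space"
  assumes cat: "CAT_neg1 (UNIV :: 'a set)" and c: "c \<in> geodesic_rays"
    and geo: "geodesic_path g l" and s: "0 \<le> s" "s \<le> l"
  shows "sinh l * exp (ray_busemann c (g s))
    \<le> sinh (l - s) * exp (ray_busemann c (g 0)) + sinh s * exp (ray_busemann c (g l))"
proof (rule tendsto_le)
  let ?E = "\<lambda>t z. 2 * exp (- t) * cosh (dist z (c t))"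
  show "((\<lambda>t. sinh l * ?E t (g s)) \<longlongrightarrow> sinh l * exp (ray_busemann c (g s))) at_top"
    by (intro tendsto_mult_left tendsto_exp_cosh_dist c)
  show "((\<lambda>t. sinh (l - s) * ?E t (g 0) + sinh s * ?E t (g l)) \<longlongrightarrow>
      sinh (l - s) * exp (ray_busemann c (g 0)) + sinh s * exp (ray_busemann c (g l))) at_top"
    by (intro tendsto_add tendsto_mult_left tendsto_exp_cosh_dist c)
  have "sinh l * ?E t (g s) \<le> sinh (l - s) * ?E t (g 0) + sinh s * ?E t (g l)" for t
    using mult_left_mono[OF CAT_neg1_cosh_convex[OF cat geo s, of "c t"], of "2 * exp (- t)"]
    by (simp add: algebra_simps dist_commute)
  then show "\<forall>\<^sub>F t in at_top. sinh l * ?E t (g s) \<le> sinh (l - s) * ?E t (g 0) + sinh s * ?E t (g l)"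
    by (rule always_eventually[OF allI])
qed simp

lemma CAT_neg1_midpoint_busemann:
  fixes x y :: "'a::metric_space"
  assumes cat: "CAT_neg1 (UNIV :: 'a set)" and c: "c \<in> geodesic_rays"
  obtains m where "\<And>p. 2 * cosh (dist x y / 2) * cosh (dist p m) \<le> cosh (dist p x) + cosh (dist p y)"
    "2 * cosh (dist x y / 2) * exp (ray_busemann c m) \<le> exp (ray_busemann c x) + exp (ray_busemann c y)"
proof -
  obtain m where m: "\<And>p. 2 * cosh (dist x y / 2) * cosh (dist p m) \<le> cosh (dist p x) + cosh (dist p y)"
    using CAT_neg1_midpoint[OF cat] by blast
  let ?E = "\<lambda>t z. 2 * exp (- t) * cosh (dist z (c t))"
  have "2 * cosh (dist x y / 2) * exp (ray_busemann c m) \<le> exp (ray_busemann c x) + exp (ray_busemann c y)"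
  proof (rule tendsto_le)
    show "((\<lambda>t. 2 * cosh (dist x y / 2) * ?E t m) \<longlongrightarrow> 2 * cosh (dist x y / 2) * exp (ray_busemann c m)) at_top"
      by (intro tendsto_mult_left tendsto_exp_cosh_dist c)
    show "((\<lambda>t. ?E t x + ?E t y) \<longlongrightarrow> exp (ray_busemann c x) + exp (ray_busemann c y)) at_top"
      by (intro tendsto_add tendsto_exp_cosh_dist c)
    have "2 * cosh (dist x y / 2) * ?E t m \<le> ?E t x + ?E t y" for t
      using mult_left_mono[OF m[of "c t"], of "2 * exp (- t)"]
      by (simp add: algebra_simps dist_commute)
    then show "\<forall>\<^sub>F t in at_top. 2 * cosh (dist x y / 2) * ?E t m \<le> ?E t x + ?E t y"
      by (rule always_eventually[OF allI])
  qed simp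
  with m show thesis by (rule that)
qed

text \<open>Here the end of the side in \<open>CAT_neg1_cosh_convex\<close> moves to infinity: the growth of
  \<open>cosh (dist q (c l))\<close> is recorded by the Busemann function. The inequality complements the trivial bound
  \<open>ray_busemann_le\<close>.\<close>

lemma cosh_dist_ray_le:
  fixes c :: "real \<Rightarrow> 'a::metric_space"
  assumes cat: "CAT_neg1 (UNIV :: 'a set)" and c: "c \<in> geodesic_rays" and s: "0 \<le> s"
  shows "cosh (dist q (c s)) \<le> exp (- s) * cosh (dist q (c 0)) + sinh s * exp (ray_busemann c q)"
proof (rule tendsto_le)
  show "((\<lambda>l. 2 * exp (- l) * sinh (l - 0) * cosh (dist q (c s))) \<longlongrightarrow> cosh (dist q (c s))) at_top"
    using tendsto_mult_right[OF tendsto_exp_sinh[of 0], of "cosh (dist q (c s))"] by simp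
  show "((\<lambda>l. 2 * exp (- l) * sinh (l - s) * cosh (dist q (c 0)) +
      sinh s * (2 * exp (- l) * cosh (dist q (c l)))) \<longlongrightarrow>
      exp (- s) * cosh (dist q (c 0)) + sinh s * exp (ray_busemann c q)) at_top"
    by (intro tendsto_add tendsto_mult_left tendsto_mult_right tendsto_exp_cosh_dist tendsto_exp_sinh c)
  show "\<forall>\<^sub>F l in at_top. 2 * exp (- l) * sinh (l - 0) * cosh (dist q (c s))
      \<le> 2 * exp (- l) * sinh (l - s) * cosh (dist q (c 0)) + sinh s * (2 * exp (- l) * cosh (dist q (c l)))"
    using eventually_ge_at_top[of s]
  proof eventually_elim
    case (elim l)
    with s show ?case
      using mult_left_mono[OF CAT_neg1_cosh_convex[OF cat geodesic_ray_path[OF c, of l] s elim, of q],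
          of "2 * exp (- l)"]
      by (simp add: algebra_simps)
  qed
qed simp

text \<open>The error bound involves the ray only through the distance of its origin to \<open>z\<close>, so the limit
  defining a Busemann function is uniform over the ideal boundary.\<close>

lemma dist_ray_le_ray_busemann:
  fixes c :: "real \<Rightarrow> 'a::metric_space"
  assumes cat: "CAT_neg1 (UNIV :: 'a set)" and c: "c \<in> geodesic_rays" and t: "0 \<le> t"
    and R: "dist z (c 0) \<le> R"
  shows "dist z (c t) - t - ray_busemann c z \<le> 2 * exp (2 * R) * exp (- t)"
proof -
  let ?\<beta> = "ray_busemann c z"
  let ?D = "dist z (c t)"
  have R0: "0 \<le> R" using R zero_le_dist order_trans by blast
  have "exp (?D - t) \<le> 2 * exp (- t) * cosh ?D" by (simp add: two_exp_cosh)
  also have "\<dots> \<le> 2 * exp (- t) * (exp (- t) * cosh (dist z (c 0)) + sinh t * exp ?\<beta>)"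
    by (intro mult_left_mono cosh_dist_ray_le cat c t) simp
  also have "\<dots> = 2 * exp (- t) * exp (- t) * cosh (dist z (c 0)) + (2 * exp (- t) * sinh t) * exp ?\<beta>"
    by (simp add: algebra_simps)
  also have "\<dots> \<le> 2 * exp (- t) * 1 * exp R + 1 * exp ?\<beta>"
  proof (intro add_mono mult_mono)
    have "cosh (dist z (c 0)) \<le> cosh R"
      using R R0 cosh_real_nonneg_le_iff[of "dist z (c 0)" R] by simp
    also have "\<dots> \<le> exp R" using R0 by (simp add: cosh_def)
    finally show "cosh (dist z (c 0)) \<le> exp R" .
    show "2 * exp (- t) * sinh t \<le> 1" by (simp add: two_exp_sinh)
  qed (use t in auto)
  finally have 1: "exp (?D - t) \<le> exp ?\<beta> + 2 * exp (- t) * exp R" by simp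
  have \<beta>: "- R \<le> ?\<beta>" using abs_ray_busemann_le[OF c, of z] R by simp
  have "1 + (?D - t - ?\<beta>) \<le> exp (?D - t - ?\<beta>)" by (rule exp_ge_add_one_self)
  also have "\<dots> = exp (- ?\<beta>) * exp (?D - t)" by (simp flip: exp_add)
  also have "\<dots> \<le> exp (- ?\<beta>) * (exp ?\<beta> + 2 * exp (- t) * exp R)"
    using 1 by (intro mult_left_mono) auto
  also have "\<dots> = 1 + 2 * exp (- t) * exp (R - ?\<beta>)"
    by (simp add: exp_diff exp_minus field_simps)
  also have "\<dots> \<le> 1 + 2 * exp (- t) * exp (2 * R)" using \<beta> by simp
  finally show ?thesis by (simp add: mult_ac)
qed

text \<open>At the midpoint of \<open>x\<close> and \<open>y\<close> the Busemann function has dropped by \<open>r - \<delta>\<close> as well, so the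
  midpoint has distance at least \<open>r - \<delta>\<close> from \<open>p\<close>; convexity of \<open>cosh (dist p z)\<close> then leaves little
  room between \<open>x\<close> and \<open>y\<close>.\<close>

lemma horoball_points_close:
  fixes c :: "real \<Rightarrow> 'a::metric_space"
  assumes cat: "CAT_neg1 (UNIV :: 'a set)" and c: "c \<in> geodesic_rays"
    and x: "dist p x \<le> r" "ray_busemann c x \<le> ray_busemann c p - r + \<delta>"
    and y: "dist p y \<le> r" "ray_busemann c y \<le> ray_busemann c p - r + \<delta>"
  shows "cosh (dist x y / 2) \<le> exp \<delta>"
proof -
  let ?C = "cosh (dist x y / 2)"
  let ?b = "exp (ray_busemann c p - r + \<delta>)"
  obtain m where m: "\<And>p. 2 * ?C * cosh (dist p m) \<le> cosh (dist p x) + cosh (dist p y)"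
    "2 * ?C * exp (ray_busemann c m) \<le> exp (ray_busemann c x) + exp (ray_busemann c y)"
    using CAT_neg1_midpoint_busemann[OF cat c, of x y] by blast
  have r: "0 \<le> r" using x(1) zero_le_dist order_trans by blast
  have "2 * exp (ray_busemann c m) \<le> 2 * ?C * exp (ray_busemann c m)"
    using cosh_real_ge_1[of "dist x y / 2"] by simp
  also have "\<dots> \<le> ?b + ?b" using m(2) x(2) y(2) by (smt (verit) exp_le_cancel_iff)
  finally have "ray_busemann c m \<le> ray_busemann c p - r + \<delta>" by simp
  then have pm: "r - \<delta> \<le> dist p m"
    using ray_busemann_le_add_dist[OF c, of p m] by simp
  have cr: "cosh (dist p x) \<le> cosh r" "cosh (dist p y) \<le> cosh r"
    using x(1) y(1) r cosh_real_nonneg_le_iff by auto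
  then have Cm: "?C * cosh (dist p m) \<le> cosh r" using m(1)[of p] by linarith
  have \<delta>: "0 \<le> \<delta>" using ray_busemann_le_add_dist[OF c, of p x] x by simp
  have "cosh r \<le> exp \<delta> * cosh (dist p m)"
  proof (cases "\<delta> \<le> r")
    case True
    have "cosh r = (exp r + exp (- r)) / 2" by (simp add: cosh_def)
    also have "\<dots> \<le> (exp r + exp (2 * \<delta> - r)) / 2" using \<delta> by simp
    also have "\<dots> = exp \<delta> * cosh (r - \<delta>)" by (simp add: cosh_def algebra_simps flip: exp_add)
    also have "\<dots> \<le> exp \<delta> * cosh (dist p m)"
      using True pm cosh_real_nonneg_le_iff[of "r - \<delta>" "dist p m"] by simp
    finally show ?thesis .
  next
    case False
    have "cosh r \<le> exp r" using r by (simp add: cosh_def)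
    also have "\<dots> \<le> exp \<delta> * 1" using False by simp
    also have "\<dots> \<le> exp \<delta> * cosh (dist p m)" by (intro mult_left_mono cosh_real_ge_1) simp
    finally show ?thesis .
  qed
  with Cm have "?C * cosh (dist p m) \<le> exp \<delta> * cosh (dist p m)" by linarith
  then show ?thesis by simp
qed

text \<open>The convex function \<open>exp \<circ> ray_busemann c\<close> tends to 0 along \<open>c'\<close> at least as fast as \<open>exp (-l)\<close>, because \<open>c'\<close>
  stays close to \<open>c\<close>. Convexity between \<open>c' 0\<close> and a far point \<open>c' l\<close> thus forces the maximal decay, and
  the Lipschitz bound forbids a faster one.\<close>

lemma asymptotic_busemann_along_ray:
  fixes c :: "real \<Rightarrow> 'a::metric_space"
  assumes cat: "CAT_neg1 (UNIV :: 'a set)" and as: "(c, c') \<in> asymptotic" and s: "0 \<le> s"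
  shows "ray_busemann c (c' s) = ray_busemann c (c' 0) - s"
proof -
  from as obtain K where c: "c \<in> geodesic_rays" and c': "c' \<in> geodesic_rays"
    and K: "\<And>t. 0 \<le> t \<Longrightarrow> dist (c t) (c' t) \<le> K" by (auto simp: asymptotic_def)
  let ?u = "\<lambda>t. exp (ray_busemann c (c' t))"
  have K': "?u l \<le> exp (K - l)" if "0 \<le> l" for l
    using ray_busemann_le_add_dist[OF c, of "c' l" "c l"] ray_busemann_along_ray[OF c that] K[OF that]
    by (simp add: dist_commute)
  have "?u s \<le> exp (- s) * ?u 0 + sinh s * (2 * (0 * exp (K) * 0))"
  proof (rule tendsto_le)
    show "((\<lambda>l. 2 * exp (- l) * sinh (l - 0) * ?u s) \<longlongrightarrow> ?u s) at_top"
      using tendsto_mult_right[OF tendsto_exp_sinh[of 0], of "?u s"] by simp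
    show "((\<lambda>l. 2 * exp (- l) * sinh (l - s) * ?u 0 +
        sinh s * (2 * (exp (- l) * exp K * exp (- l)))) \<longlongrightarrow>
        exp (- s) * ?u 0 + sinh s * (2 * (0 * exp (K) * 0))) at_top"
      by (rule tendsto_add[OF tendsto_mult_right[OF tendsto_exp_sinh]
            tendsto_mult_left[OF tendsto_mult_left[OF tendsto_mult[OF
                tendsto_mult_right[OF exp_uminus_at_top] exp_uminus_at_top]]]])
    show "\<forall>\<^sub>F l in at_top. 2 * exp (- l) * sinh (l - 0) * ?u s
      \<le> 2 * exp (- l) * sinh (l - s) * ?u 0 + sinh s * (2 * (exp (- l) * exp K * exp (- l)))"
      using eventually_ge_at_top[of s]
    proof eventually_elim
      case (elim l)
      with s have l: "0 \<le> l" by simp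
      have "sinh l * ?u s \<le> sinh (l - s) * ?u 0 + sinh s * ?u l"
        by (rule exp_ray_busemann_convex[OF cat c geodesic_ray_path[OF c' l] s elim])
      also have "\<dots> \<le> sinh (l - s) * ?u 0 + sinh s * exp (K - l)"
        using K'[OF l] s by (intro add_left_mono mult_left_mono) auto
      finally have "2 * exp (- l) * (sinh l * ?u s)
          \<le> 2 * exp (- l) * (sinh (l - s) * ?u 0 + sinh s * exp (K - l))"
        by (intro mult_left_mono) auto
      then show ?case by (simp add: algebra_simps exp_diff exp_minus divide_inverse)
    qed
  qed simp
  then have "?u s \<le> exp (ray_busemann c (c' 0) - s)" by (simp flip: exp_add)
  moreover have "ray_busemann c (c' 0) \<le> ray_busemann c (c' s) + s"
    using ray_busemann_le_add_dist[OF c, of "c' 0" "c' s"] geodesic_rayD[OF c', of 0 s] s by simp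
  ultimately show ?thesis by simp
qed

text \<open>In the quadrilateral \<open>c 0\<close>, \<open>c t\<close>, \<open>c' t\<close>, \<open>c' 0\<close> two opposite sides have bounded length. Then the
  diagonals cannot together exceed \<open>2t\<close> in the limit: both remaining vertices are close enough to the
  midpoint \<open>n\<close> of one diagonal to bound the other one through \<open>n\<close>.\<close>

lemma asymptotic_busemann_sum_nonpos:
  fixes c :: "real \<Rightarrow> 'a::metric_space"
  assumes cat: "CAT_neg1 (UNIV :: 'a set)" and as: "(c, c') \<in> asymptotic"
  shows "ray_busemann c (c' 0) + ray_busemann c' (c 0) \<le> 0"
proof -
  from as obtain K where c: "c \<in> geodesic_rays" and c': "c' \<in> geodesic_rays"
    and K: "\<And>t. 0 \<le> t \<Longrightarrow> dist (c t) (c' t) \<le> K" by (auto simp: asymptotic_def)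
  have K0: "0 \<le> K" using K[of 0] zero_le_dist order_trans by blast
  have quad: "(1 + cosh (dist (c 0) (c' t))) * cosh (dist (c' 0) (c t)) \<le> (cosh t + cosh K)\<^sup>2"
    if t: "0 \<le> t" for t
  proof -
    let ?h = "dist (c 0) (c' t) / 2"
    obtain n where n: "\<And>p. 2 * cosh ?h * cosh (dist p n) \<le> cosh (dist p (c 0)) + cosh (dist p (c' t))"
      using CAT_neg1_midpoint[OF cat, of "c 0" "c' t"] by blast
    have cK: "cosh (dist (c' 0) (c 0)) \<le> cosh K" "cosh (dist (c t) (c' t)) \<le> cosh K"
      using K[of 0] K[OF t] K0 cosh_real_nonneg_le_iff by (auto simp: dist_commute)
    have n1: "2 * cosh ?h * cosh (dist (c t) n) \<le> cosh t + cosh K"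
      using n[of "c t"] cK geodesic_rayD[OF c, of t 0] t by simp
    have n2: "2 * cosh ?h * cosh (dist (c' 0) n) \<le> cosh t + cosh K"
      using n[of "c' 0"] cK geodesic_rayD[OF c', of 0 t] t by simp
    have "cosh (dist (c' 0) (c t)) \<le> cosh (dist (c' 0) n + dist (c t) n)"
      using dist_triangle[of "c' 0" "c t" n] by (simp add: cosh_real_nonneg_le_iff dist_commute)
    also have "\<dots> \<le> cosh (dist (c' 0) n) * cosh (dist (c t) n) + cosh (dist (c' 0) n) * cosh (dist (c t) n)"
      unfolding cosh_add by (intro add_left_mono mult_mono) (auto simp: sinh_le_cosh_real)
    finally have "(1 + cosh (dist (c 0) (c' t))) * cosh (dist (c' 0) (c t))
      \<le> (1 + cosh (dist (c 0) (c' t))) * (2 * cosh (dist (c' 0) n) * cosh (dist (c t) n))"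
      by (intro mult_left_mono) (simp_all add: add_nonneg_nonneg mult_ac)
    also have "\<dots> = (2 * cosh ?h * cosh (dist (c t) n)) * (2 * cosh ?h * cosh (dist (c' 0) n))"
      using cosh_double_cosh[of ?h] by (simp add: power2_eq_square)
    also have "\<dots> \<le> (cosh t + cosh K) * (cosh t + cosh K)"
      by (intro mult_mono n1 n2) auto
    finally show ?thesis by (simp add: power2_eq_square)
  qed
  let ?E = "\<lambda>t. (2 * exp (- t) + 2 * exp (- t) * cosh (dist (c 0) (c' t))) * (2 * exp (- t) * cosh (dist (c' 0) (c t)))"
  have "(2 * 0 + exp (ray_busemann c' (c 0))) * exp (ray_busemann c (c' 0)) \<le> (1 + 2 * 0 * cosh K)\<^sup>2"
  proof (rule tendsto_le)
    show "(?E \<longlongrightarrow> (2 * 0 + exp (ray_busemann c' (c 0))) * exp (ray_busemann c (c' 0))) at_top"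
      by (rule tendsto_mult[OF tendsto_add[OF tendsto_mult_left[OF exp_uminus_at_top]
            tendsto_exp_cosh_dist[OF c']] tendsto_exp_cosh_dist[OF c]])
    show "((\<lambda>t. (2 * exp (- t) * cosh t + 2 * exp (- t) * cosh K)\<^sup>2) \<longlongrightarrow> (1 + 2 * 0 * cosh K)\<^sup>2) at_top"
      by (rule tendsto_power[OF tendsto_add[OF tendsto_exp_cosh
            tendsto_mult_right[OF tendsto_mult_left[OF exp_uminus_at_top]]]])
    show "\<forall>\<^sub>F t in at_top. ?E t \<le> (2 * exp (- t) * cosh t + 2 * exp (- t) * cosh K)\<^sup>2"
      using eventually_ge_at_top[of 0]
    proof eventually_elim
      case (elim t)
      have "(2 * exp (- t))\<^sup>2 * ((1 + cosh (dist (c 0) (c' t))) * cosh (dist (c' 0) (c t)))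
          \<le> (2 * exp (- t))\<^sup>2 * (cosh t + cosh K)\<^sup>2"
        using quad[OF elim] by (intro mult_left_mono) auto
      then show ?case by (simp add: power2_eq_square algebra_simps)
    qed
  qed simp
  then have "exp (ray_busemann c' (c 0) + ray_busemann c (c' 0)) \<le> exp 0" by (simp add: exp_add)
  then show ?thesis by (simp only: exp_le_cancel_iff)
qed

lemma asymptotic_sym: "(c, c') \<in> asymptotic \<Longrightarrow> (c', c) \<in> asymptotic"
  by (auto simp: asymptotic_def dist_commute)

text \<open>By the Lipschitz bound along \<open>c'\<close>, \<open>ray_busemann c\<close> is at most \<open>ray_busemann c'\<close> plus
  \<open>ray_busemann c (c' 0)\<close>. The reverse inequality is the same bound with the rays exchanged, since the two
  constants have a sum of at most 0.\<close>

lemma ray_busemann_asymptotic: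
  fixes c :: "real \<Rightarrow> 'a::metric_space"
  assumes cat: "CAT_neg1 (UNIV :: 'a set)" and as: "(c, c') \<in> asymptotic"
  shows "ray_busemann c z = ray_busemann c' z + ray_busemann c (c' 0)"
proof -
  have le: "ray_busemann d z \<le> ray_busemann d' z + ray_busemann d (d' 0)"
    if dd': "(d, d') \<in> asymptotic" for d d' :: "real \<Rightarrow> 'a"
  proof (rule tendsto_le)
    have d: "d \<in> geodesic_rays" "d' \<in> geodesic_rays" using dd' by (auto simp: asymptotic_def)
    show "((\<lambda>t. dist z (d' t) - t + ray_busemann d (d' 0)) \<longlongrightarrow> ray_busemann d' z + ray_busemann d (d' 0)) at_top"
      by (intro tendsto_add tendsto_ray_busemann d tendsto_const)
    show "((\<lambda>t. ray_busemann d z) \<longlongrightarrow> ray_busemann d z) at_top" by simp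
    show "\<forall>\<^sub>F t in at_top. ray_busemann d z \<le> dist z (d' t) - t + ray_busemann d (d' 0)"
      using eventually_ge_at_top[of 0]
    proof eventually_elim
      case (elim t)
      show ?case
        using ray_busemann_le_add_dist[OF d(1), of z "d' t"]
          asymptotic_busemann_along_ray[OF cat dd' elim] by simp
    qed
  qed simp
  from le[OF as] le[OF asymptotic_sym[OF as]] asymptotic_busemann_sum_nonpos[OF cat as]
  show ?thesis by simp
qed

section \<open>Rays towards a point of the ideal boundary\<close>

lemma continuous_on_ray_busemann:
  assumes c: "c \<in> geodesic_rays"
  shows "continuous_on A (ray_busemann c)"
proof -
  have "1-lipschitz_on A (ray_busemann c)"
  proof (rule lipschitz_onI)
    fix x y
    show "dist (ray_busemann c x) (ray_busemann c y) \<le> 1 * dist x y"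
      using ray_busemann_le_add_dist[OF c, of x y] ray_busemann_le_add_dist[OF c, of y x]
      by (simp add: dist_real_def dist_commute abs_le_iff)
  qed simp
  then show ?thesis by (rule lipschitz_on_continuous_on)
qed

lemma equiv_asymptotic: "equiv (geodesic_rays :: (real \<Rightarrow> 'a::metric_space) set) asymptotic"
proof (rule equivI)
  show "asymptotic \<subseteq> geodesic_rays \<times> geodesic_rays" by (auto simp: asymptotic_def)
  show "refl_on geodesic_rays asymptotic" by (auto simp: refl_on_def asymptotic_def)
  show "sym asymptotic" by (auto intro: symI asymptotic_sym)
  show "trans (asymptotic :: ((real \<Rightarrow> 'a) \<times> (real \<Rightarrow> 'a)) set)"
  proof (rule transI)
    fix x y z :: "real \<Rightarrow> 'a"
    assume "(x, y) \<in> asymptotic" "(y, z) \<in> asymptotic"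
    then obtain K L where KL: "x \<in> geodesic_rays" "z \<in> geodesic_rays"
      "\<And>t. 0 \<le> t \<Longrightarrow> dist (x t) (y t) \<le> K" "\<And>t. 0 \<le> t \<Longrightarrow> dist (y t) (z t) \<le> L"
      by (auto simp: asymptotic_def)
    have "dist (x t) (z t) \<le> K + L" if "0 \<le> t" for t
      using KL(3,4)[OF that] dist_triangle[of "x t" "z t" "y t"] by linarith
    with KL(1,2) show "(x, z) \<in> asymptotic" unfolding asymptotic_def by blast
  qed
qed

context
  assumes cat: "CAT_neg1 (UNIV :: 'a::heine_borel set)"
begin

lemma busemann_steepest_point_unique:
  fixes c :: "real \<Rightarrow> 'a"
  assumes c: "c \<in> geodesic_rays"
    and "dist p x \<le> r" "ray_busemann c x \<le> ray_busemann c p - r"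
    and "dist p y \<le> r" "ray_busemann c y \<le> ray_busemann c p - r"
  shows "x = y"
proof -
  have "cosh (dist x y / 2) \<le> 1"
    using horoball_points_close[OF cat c, of p x r 0 y] assms by simp
  then have "cosh (dist x y / 2) = 1" using cosh_real_ge_1[of "dist x y / 2"] by linarith
  then show ?thesis by simp
qed

text \<open>The points at distance \<open>r\<close> from \<open>p\<close> on the geodesics towards \<open>c t\<close> nearly satisfy the bound for
  large \<open>t\<close>; a minimum of the Busemann function on the compact ball satisfies it.\<close>

lemma busemann_steepest_point_exists:
  fixes c :: "real \<Rightarrow> 'a"
  assumes c: "c \<in> geodesic_rays" and r: "0 \<le> r"
  shows "\<exists>x. dist p x \<le> r \<and> ray_busemann c x \<le> ray_busemann c p - r"
proof -
  obtain x where x: "x \<in> cball p r" and min: "\<And>y. y \<in> cball p r \<Longrightarrow> ray_busemann c x \<le> ray_busemann c y"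
    using continuous_attains_inf[OF compact_cball _ continuous_on_ray_busemann[OF c], of p r] r by force
  have "ray_busemann c x \<le> ray_busemann c p - r"
  proof (rule tendsto_le)
    show "((\<lambda>t. ray_busemann c x) \<longlongrightarrow> ray_busemann c x) at_top" by simp
    show "((\<lambda>t. (dist p (c t) - t) - r) \<longlongrightarrow> ray_busemann c p - r) at_top"
      by (intro tendsto_diff tendsto_ray_busemann c tendsto_const)
    show "\<forall>\<^sub>F t in at_top. ray_busemann c x \<le> (dist p (c t) - t) - r"
      using eventually_ge_at_top[of "r + dist p (c 0)"]
    proof eventually_elim
      case (elim t)
      with r have t: "0 \<le> t" by (meson add_nonneg_nonneg order_trans zero_le_dist)
      have "t \<le> dist p (c 0) + dist p (c t)"
        using dist_triangle[of "c 0" "c t" p] geodesic_rayD[OF c, of 0 t] t by (simp add: dist_commute)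
      with elim have D: "r \<le> dist p (c t)" by simp
      obtain g where g: "geodesic_path g (dist p (c t))" "g 0 = p" "g (dist p (c t)) = c t"
        using CAT_neg1_geodesic[OF cat] .
      have gd: "dist p (g r) = r" "dist (g r) (c t) = dist p (c t) - r"
        using geodesic_pathD[OF g(1), of 0 r] geodesic_pathD[OF g(1), of r "dist p (c t)"] g(2,3) D r
        by simp_all
      have "ray_busemann c x \<le> ray_busemann c (g r)" using min gd(1) by simp
      also have "\<dots> \<le> dist (g r) (c t) - t" by (rule ray_busemann_le[OF c t])
      finally show ?case using gd(2) by simp
    qed
  qed simp
  with x show ?thesis by auto
qed

text \<open>The points \<open>x r\<close> of steepest descent of the Busemann function of \<open>c\<close> form the required ray: a
  geodesic from \<open>p\<close> to \<open>x t\<close> consists of points of steepest descent, so it passes through \<open>x s\<close> by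
  uniqueness.\<close>

lemma asymptotic_ray_exists:
  fixes c :: "real \<Rightarrow> 'a"
  assumes c: "c \<in> geodesic_rays"
  shows "\<exists>c'. (c, c') \<in> asymptotic \<and> c' 0 = p"
proof -
  obtain x where x: "\<And>r. 0 \<le> r \<Longrightarrow> dist p (x r) \<le> r"
      "\<And>r. 0 \<le> r \<Longrightarrow> ray_busemann c (x r) \<le> ray_busemann c p - r"
    using busemann_steepest_point_exists[OF c, of _ p] by metis
  \<comment> \<open>The Lipschitz bound gives one inequality, the geodesic from \<open>p\<close> to \<open>x t\<close> the other.\<close>
  have dist_x: "dist (x s) (x t) = t - s" if st: "0 \<le> s" "s \<le> t" for s t
  proof (rule antisym)
    have t: "0 \<le> t" using st by simp
    have pt: "dist p (x t) = t"
      using x[OF t] ray_busemann_le_add_dist[OF c, of p "x t"] by simp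
    obtain g where g: "geodesic_path g (dist p (x t))" "g 0 = p" "g (dist p (x t)) = x t"
      using CAT_neg1_geodesic[OF cat] .
    have "dist p (g s) = s" "dist (g s) (x t) = t - s"
      using geodesic_pathD[OF g(1), of 0 s] geodesic_pathD[OF g(1), of s t] g(2,3) st pt by simp_all
    moreover from this have "ray_busemann c (g s) \<le> ray_busemann c p - s"
      using ray_busemann_le_add_dist[OF c, of "g s" "x t"] x(2)[OF t] by simp
    ultimately have "x s = g s"
      using busemann_steepest_point_unique[OF c] x[OF st(1)] by (metis order_refl)
    with \<open>dist (g s) (x t) = t - s\<close> show "dist (x s) (x t) \<le> t - s" by simp
    have "ray_busemann c p - s \<le> ray_busemann c (x s)"
      using ray_busemann_le_add_dist[OF c, of p "x s"] x(1)[OF st(1)] by simp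
    then show "t - s \<le> dist (x s) (x t)"
      using ray_busemann_le_add_dist[OF c, of "x s" "x t"] x(2)[OF t] by simp
  qed
  let ?c' = "restrict x {0..}"
  have c': "?c' \<in> geodesic_rays"
    unfolding geodesic_rays_def
  proof (intro CollectI conjI allI impI)
    fix s t :: real assume "0 \<le> s" "0 \<le> t"
    then show "dist (?c' s) (?c' t) = \<bar>s - t\<bar>"
      using dist_x[of s t] dist_x[of t s] by (cases "s \<le> t") (auto simp: dist_commute)
  qed simp
  have bound: "dist (c t) (?c' t) \<le> 4 * exp (dist p (c 0))" if t: "0 \<le> t" for t
  proof -
    let ?D = "dist p (c 0)"
    let ?d = "dist (x t) (c t)"
    have D1: "dist (x t) (c 0) \<le> t + ?D"
      using dist_triangle[of "x t" "c 0" p] x(1)[OF t] by (simp add: dist_commute)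
    have D2: "ray_busemann c (x t) \<le> ?D - t"
      using x(2)[OF t] abs_ray_busemann_le[OF c, of p] by simp
    have "cosh (dist (x t) (c 0)) \<le> exp (dist (x t) (c 0))" by (simp add: cosh_def)
    also have "\<dots> \<le> exp (t + ?D)" using D1 by simp
    finally have "exp (- t) * cosh (dist (x t) (c 0)) \<le> exp (- t) * exp (t + ?D)" by simp
    moreover have "sinh t * exp (ray_busemann c (x t)) \<le> exp t * exp (?D - t)"
      using D2 sinh_le_cosh_real[of t] cosh_plus_sinh[of t] cosh_real_nonneg[of t]
      by (intro mult_mono) (auto simp del: cosh_real_nonneg)
    ultimately have "cosh ?d \<le> 2 * exp ?D"
      using cosh_dist_ray_le[OF cat c t, of "x t"] by (simp flip: exp_add)
    moreover have "?d \<le> 2 * cosh ?d"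
      using exp_ge_add_one_self[of ?d] cosh_plus_sinh[of ?d] sinh_le_cosh_real[of ?d] by linarith
    ultimately show ?thesis using t by (simp add: dist_commute)
  qed
  have "?c' 0 = p" using x(1)[of 0] by simp
  moreover have "(c, ?c') \<in> asymptotic"
    using c c' bound unfolding asymptotic_def by blast
  ultimately show ?thesis by blast
qed

lemma asymptotic_ray_unique:
  fixes c c' :: "real \<Rightarrow> 'a"
  assumes as: "(c, c') \<in> asymptotic" and start: "c 0 = c' 0"
  shows "c = c'"
proof (rule extensionalityI)
  from as have c: "c \<in> geodesic_rays" and c': "c' \<in> geodesic_rays" by (auto simp: asymptotic_def)
  then show "c \<in> extensional {0..}" "c' \<in> extensional {0..}" by (auto simp: geodesic_rays_def)
  fix t :: real assume "t \<in> {0..}"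
  then have t: "0 \<le> t" by simp
  show "c t = c' t"
  proof (rule busemann_steepest_point_unique[OF c])
    show "dist (c 0) (c t) \<le> t" "dist (c 0) (c' t) \<le> t"
      using geodesic_rayD[OF c, of 0 t] geodesic_rayD[OF c', of 0 t] t start by auto
    show "ray_busemann c (c t) \<le> ray_busemann c (c 0) - t"
      using ray_busemann_along_ray[OF c] t by simp
    show "ray_busemann c (c' t) \<le> ray_busemann c (c 0) - t"
      using asymptotic_busemann_along_ray[OF cat as t] start by simp
  qed
qed

lemma ray_from_unique:
  fixes \<xi> :: "(real \<Rightarrow> 'a) set"
  assumes \<xi>: "\<xi> \<in> ideal_boundary" and c: "c \<in> \<xi>"
  shows "ray_from (c 0) \<xi> = c"
  unfolding ray_from_def
proof (rule the_equality)
  show "c \<in> \<xi> \<and> c 0 = c 0" using c by simp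
  fix c' assume "c' \<in> \<xi> \<and> c' 0 = c 0"
  moreover from this have "(c', c) \<in> asymptotic"
    using in_quotient_imp_in_rel[OF equiv_asymptotic \<xi>[unfolded ideal_boundary_def]] c by blast
  ultimately show "c' = c" using asymptotic_ray_unique by blast
qed

lemma ray_from_in:
  fixes \<xi> :: "(real \<Rightarrow> 'a) set"
  assumes \<xi>: "\<xi> \<in> ideal_boundary"
  shows "ray_from p \<xi> \<in> \<xi>" and "ray_from p \<xi> 0 = p"
proof -
  note \<xi>' = \<xi>[unfolded ideal_boundary_def]
  obtain c where c: "c \<in> \<xi>" using in_quotient_imp_non_empty[OF equiv_asymptotic \<xi>'] by blast
  then have "c \<in> geodesic_rays" using in_quotient_imp_subset[OF equiv_asymptotic \<xi>'] by blast
  then obtain c' where c': "(c, c') \<in> asymptotic" "c' 0 = p" using asymptotic_ray_exists by blast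
  have "c' \<in> \<xi>" by (rule in_quotient_imp_closed[OF equiv_asymptotic \<xi>' c c'(1)])
  then show "ray_from p \<xi> \<in> \<xi>" "ray_from p \<xi> 0 = p"
    using ray_from_unique[OF \<xi>, of c'] c'(2) by auto
qed

lemma ray_from_ray:
  fixes \<xi> :: "(real \<Rightarrow> 'a) set"
  assumes "\<xi> \<in> ideal_boundary"
  shows "ray_from p \<xi> \<in> geodesic_rays"
  using ray_from_in(1)[OF assms] in_quotient_imp_subset[OF equiv_asymptotic assms[unfolded ideal_boundary_def]]
  by blast

lemma ray_from_asymptotic:
  fixes \<xi> :: "(real \<Rightarrow> 'a) set"
  assumes "\<xi> \<in> ideal_boundary"
  shows "(ray_from p \<xi>, ray_from q \<xi>) \<in> asymptotic"
  using ray_from_in(1)[OF assms] in_quotient_imp_in_rel[OF equiv_asymptotic assms[unfolded ideal_boundary_def]]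
  by blast

lemma busemann_eq_ray_busemann: "busemann \<xi> p z = ray_busemann (ray_from p \<xi>) z"
  by (simp add: busemann_def ray_busemann_def)

lemma busemann_change_base:
  fixes \<xi> :: "(real \<Rightarrow> 'a) set"
  assumes \<xi>: "\<xi> \<in> ideal_boundary"
  shows "busemann \<xi> q z = busemann \<xi> p z - busemann \<xi> p q"
  using ray_busemann_asymptotic[OF cat ray_from_asymptotic[OF \<xi>, of p q], of z] ray_from_in(2)[OF \<xi>, of q]
  by (simp add: busemann_eq_ray_busemann)

lemma busemann_along_ray:
  fixes \<xi> :: "(real \<Rightarrow> 'a) set"
  assumes \<xi>: "\<xi> \<in> ideal_boundary" and t: "0 \<le> t"
  shows "busemann \<xi> p (ray_from q \<xi> t) = busemann \<xi> p q - t"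
  using asymptotic_busemann_along_ray[OF cat ray_from_asymptotic[OF \<xi>, of p q] t] ray_from_in(2)[OF \<xi>, of q]
  by (simp add: busemann_eq_ray_busemann)

lemma abs_busemann_le:
  fixes \<xi> :: "(real \<Rightarrow> 'a) set"
  assumes \<xi>: "\<xi> \<in> ideal_boundary"
  shows "\<bar>busemann \<xi> p z\<bar> \<le> dist z p"
  using abs_ray_busemann_le[OF ray_from_ray[OF \<xi>], of p z] ray_from_in(2)[OF \<xi>, of p]
  by (simp add: busemann_eq_ray_busemann)

lemma continuous_on_busemann:
  fixes \<xi> :: "(real \<Rightarrow> 'a) set"
  assumes \<xi>: "\<xi> \<in> ideal_boundary"
  shows "continuous_on A (busemann \<xi> p)"
  using continuous_on_ray_busemann[OF ray_from_ray[OF \<xi>]]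
  by (simp add: busemann_eq_ray_busemann[abs_def])

lemma busemann_uniform:
  fixes \<xi> :: "(real \<Rightarrow> 'a) set"
  assumes \<xi>: "\<xi> \<in> ideal_boundary" and t: "0 \<le> t" and R: "dist z p \<le> R"
  shows "\<bar>dist z (ray_from p \<xi> t) - t - busemann \<xi> p z\<bar> \<le> 2 * exp (2 * R) * exp (- t)"
  using dist_ray_le_ray_busemann[OF cat ray_from_ray[OF \<xi>] t, of z p R]
    ray_busemann_le[OF ray_from_ray[OF \<xi>] t, of p z] ray_from_in(2)[OF \<xi>, of p] R
  by (simp add: busemann_eq_ray_busemann)

text \<open>On the ball of radius \<open>r\<close> about \<open>x\<close>, the point at time \<open>r\<close> on the ray to \<open>\<xi>\<close> is almost a point of
  steepest descent for \<open>\<eta>\<close> too, so \<open>horoball_points_close\<close> applies.\<close>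

lemma ray_from_close:
  fixes \<xi> \<eta> :: "(real \<Rightarrow> 'a) set"
  assumes \<xi>: "\<xi> \<in> ideal_boundary" and \<eta>: "\<eta> \<in> ideal_boundary" and r: "0 \<le> r"
    and o: "\<bar>busemann \<eta> q x - busemann \<xi> p x - k\<bar> \<le> \<delta>"
    and ro: "\<bar>busemann \<eta> q (ray_from x \<xi> r) - busemann \<xi> p (ray_from x \<xi> r) - k\<bar> \<le> \<delta>"
  shows "cosh (dist (ray_from x \<eta> r) (ray_from x \<xi> r) / 2) \<le> exp (2 * \<delta>)"
proof (rule horoball_points_close[OF cat ray_from_ray[OF \<eta>, of q], of x _ r], goal_cases)
  case 1
  then show ?case using geodesic_rayD[OF ray_from_ray[OF \<eta>], of 0 r x] ray_from_in(2)[OF \<eta>, of x] r by simp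
next
  case 2
  then show ?case
    using busemann_along_ray[OF \<eta> r, of q x] o by (simp add: busemann_eq_ray_busemann[symmetric])
next
  case 3
  then show ?case using geodesic_rayD[OF ray_from_ray[OF \<xi>], of 0 r x] ray_from_in(2)[OF \<xi>, of x] r by simp
next
  case 4
  then show ?case
    using busemann_along_ray[OF \<xi> r, of p x] o ro
    unfolding busemann_eq_ray_busemann[symmetric] by linarith
qed

lemma ideal_boundary_eqI:
  fixes \<xi> \<eta> :: "(real \<Rightarrow> 'a) set"
  assumes \<xi>: "\<xi> \<in> ideal_boundary" and \<eta>: "\<eta> \<in> ideal_boundary"
    and eq: "\<And>x. busemann \<eta> q x = busemann \<xi> p x + k"
  shows "\<eta> = \<xi>"
proof -
  have "ray_from p \<eta> = ray_from p \<xi>"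
  proof (rule extensionalityI)
    show "ray_from p \<eta> \<in> extensional {0..}" "ray_from p \<xi> \<in> extensional {0..}"
      using ray_from_ray[OF \<xi>] ray_from_ray[OF \<eta>] by (auto simp: geodesic_rays_def)
    fix r :: real assume "r \<in> {0..}"
    then have "cosh (dist (ray_from p \<eta> r) (ray_from p \<xi> r) / 2) \<le> 1"
      using ray_from_close[OF \<xi> \<eta>, of r q p p k 0] eq by simp
    then have "cosh (dist (ray_from p \<eta> r) (ray_from p \<xi> r) / 2) = 1"
      using cosh_real_ge_1 by (intro antisym)
    then show "ray_from p \<eta> r = ray_from p \<xi> r" by simp
  qed
  then have "ray_from p \<xi> \<in> \<eta>" using ray_from_in(1)[OF \<eta>, of p] by simp
  then show ?thesis
    using quotient_disj[OF equiv_asymptotic, of \<xi> \<eta>] \<xi> \<eta> ray_from_in(1)[OF \<xi>, of p]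
    unfolding ideal_boundary_def by blast
qed

end

section \<open>Continuous functions modulo constants\<close>

text \<open>The sets generating the topology are uniform neighbourhoods of arbitrary centres; the supremum
  over a compact set being attained, each contains a uniform neighbourhood of any of its members.\<close>

lemma compact_convergence_nbhd_base:
  assumes "openin compact_convergence_topology U" and "f \<in> U"
  shows "\<exists>K e. compact K \<and> 0 < e \<and> {g \<in> continuous_functions. \<forall>x\<in>K. \<bar>g x - f x\<bar> < e} \<subseteq> U"
  using openin_topology_generated_by[OF assms(1)[unfolded compact_convergence_topology_def]] assms(2)
proof (induction arbitrary: f)
  case Empty
  then show ?case by simp
next
  case (Int U V)
  obtain K e where K: "compact K" "0 < e"
    and sub: "{g \<in> continuous_functions. \<forall>x\<in>K. \<bar>g x - f x\<bar> < e} \<subseteq> U"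
    using Int.IH(1)[of f] Int.prems by blast
  obtain L d where L: "compact L" "0 < d"
    and sub': "{g \<in> continuous_functions. \<forall>x\<in>L. \<bar>g x - f x\<bar> < d} \<subseteq> V"
    using Int.IH(2)[of f] Int.prems by blast
  show ?case
  proof (intro exI conjI)
    show "compact (K \<union> L)" "0 < min e d" using K L by (auto intro: compact_Un)
    show "{g \<in> continuous_functions. \<forall>x\<in>K \<union> L. \<bar>g x - f x\<bar> < min e d} \<subseteq> U \<inter> V"
      using sub sub' by auto
  qed
next
  case (UN \<K>)
  then obtain V where V: "V \<in> \<K>" "f \<in> V" by blast
  from UN.IH[OF this] obtain K e where "compact K" "0 < e"
    "{g \<in> continuous_functions. \<forall>x\<in>K. \<bar>g x - f x\<bar> < e} \<subseteq> V" by blast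
  with V(1) show ?case by blast
next
  case (Basis B)
  then obtain h K e where B: "B = {g \<in> continuous_functions. \<forall>x\<in>K. \<bar>g x - h x\<bar> < e}"
    and h: "h \<in> continuous_functions" and K: "compact K" and e: "0 < e" by blast
  have f: "f \<in> continuous_functions" "\<forall>x\<in>K. \<bar>f x - h x\<bar> < e" using Basis.prems B by auto
  obtain m where m: "m < e" "\<forall>x\<in>K. \<bar>f x - h x\<bar> \<le> m"
  proof (cases "K = {}")
    case True
    with that[of 0] e show thesis by simp
  next
    case False
    have "continuous_on K (\<lambda>x. \<bar>f x - h x\<bar>)"
      using f h unfolding continuous_functions_def
      by (auto intro!: continuous_intros elim: continuous_on_subset)
    then obtain x where "x \<in> K" "\<forall>y\<in>K. \<bar>f y - h y\<bar> \<le> \<bar>f x - h x\<bar>"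
      using continuous_attains_sup[OF K False] by blast
    with f(2) that show thesis by blast
  qed
  have "{g \<in> continuous_functions. \<forall>x\<in>K. \<bar>g x - f x\<bar> < e - m} \<subseteq> B"
    using m(2) unfolding B by fastforce
  moreover have "0 < e - m" using m(1) by simp
  ultimately show ?case using K by blast
qed

lemma topspace_compact_convergence [simp]:
  "topspace compact_convergence_topology = continuous_functions"
proof -
  have "f \<in> \<Union>{{g \<in> continuous_functions. \<forall>x\<in>K. \<bar>g x - h x\<bar> < e} | h K e.
      h \<in> continuous_functions \<and> compact K \<and> 0 < e}"
    if "f \<in> continuous_functions" for f :: "'a \<Rightarrow> real"
    by (rule UnionI[of "{g \<in> continuous_functions. \<forall>x\<in>{}. \<bar>g x - f x\<bar> < 1}"])
      (use that compact_empty zero_less_one in blast)+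
  then show ?thesis unfolding compact_convergence_topology_def by auto
qed

lemma continuous_map_compact_convergenceI:
  fixes F :: "'b \<Rightarrow> 'c::topological_space \<Rightarrow> real"
  assumes "\<And>x. x \<in> topspace X \<Longrightarrow> F x \<in> continuous_functions"
    and "\<And>x K e. x \<in> topspace X \<Longrightarrow> compact K \<Longrightarrow> 0 < e \<Longrightarrow>
      \<exists>U. openin X U \<and> x \<in> U \<and> (\<forall>y\<in>U. \<forall>z\<in>K. \<bar>F y z - F x z\<bar> < e)"
  shows "continuous_map X compact_convergence_topology F"
  unfolding continuous_map_def
proof (intro conjI allI impI)
  show "F \<in> topspace X \<rightarrow> topspace compact_convergence_topology" using assms(1) by auto
  fix V :: "('c \<Rightarrow> real) set" assume V: "openin compact_convergence_topology V"
  show "openin X {x \<in> topspace X. F x \<in> V}"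
  proof (subst openin_subopen, intro ballI)
    fix x assume x: "x \<in> {x \<in> topspace X. F x \<in> V}"
    then obtain K e where "compact K" "0 < e"
      and sub: "{g \<in> continuous_functions. \<forall>z\<in>K. \<bar>g z - F x z\<bar> < e} \<subseteq> V"
      using compact_convergence_nbhd_base[OF V, of "F x"] x by blast
    then obtain U where U: "openin X U" "x \<in> U" "\<forall>y\<in>U. \<forall>z\<in>K. \<bar>F y z - F x z\<bar> < e"
      using assms(2)[of x K e] x by blast
    moreover have "U \<subseteq> {x \<in> topspace X. F x \<in> V}"
      using openin_subset[OF U(1)] U(3) assms(1) sub by blast
    ultimately show "\<exists>T. openin X T \<and> x \<in> T \<and> T \<subseteq> {x \<in> topspace X. F x \<in> V}" by blast
  qed
qed

lemma const_class_eq_iff: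
  assumes "f \<in> continuous_functions" "g \<in> continuous_functions"
  shows "const_class f = const_class g \<longleftrightarrow> (\<exists>k. \<forall>x. g x = f x + k)"
proof
  assume "const_class f = const_class g"
  moreover have "g \<in> const_class g"
    using assms by (auto simp: const_class_def differ_by_const_def intro: exI[of _ 0])
  ultimately have "g \<in> const_class f" by simp
  then show "\<exists>k. \<forall>x. g x = f x + k"
    by (simp add: const_class_def differ_by_const_def)
next
  assume "\<exists>k. \<forall>x. g x = f x + k"
  then obtain k where k: "\<And>x. g x = f x + k" by blast
  have "(\<exists>l. \<forall>x. h x = f x + l) \<longleftrightarrow> (\<exists>l. \<forall>x. h x = g x + l)" for h
  proof
    assume "\<exists>l. \<forall>x. h x = f x + l"
    then obtain l where "\<forall>x. h x = f x + l" ..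
    then have "\<forall>x. h x = g x + (l - k)" using k by simp
    then show "\<exists>l. \<forall>x. h x = g x + l" ..
  next
    assume "\<exists>l. \<forall>x. h x = g x + l"
    then obtain l where "\<forall>x. h x = g x + l" ..
    then have "\<forall>x. h x = f x + (k + l)" using k by simp
    then show "\<exists>l. \<forall>x. h x = f x + l" ..
  qed
  with assms show "const_class f = const_class g"
    by (auto simp: const_class_def differ_by_const_def)
qed

lemma topspace_quotient_topology: "topspace (quotient_topology T f) = f ` topspace T"
proof
  show "topspace (quotient_topology T f) \<subseteq> f ` topspace T"
    using openin_topspace[of "quotient_topology T f"] unfolding openin_quotient_topology by blast
  have "{x \<in> topspace T. f x \<in> f ` topspace T} = topspace T" by auto
  then have "openin (quotient_topology T f) (f ` topspace T)" by (simp add: openin_quotient_topology)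
  then show "f ` topspace T \<subseteq> topspace (quotient_topology T f)" by (rule openin_subset)
qed

lemma continuous_map_quotient_topology: "continuous_map T (quotient_topology T f) f"
  by (simp add: continuous_map_def topspace_quotient_topology openin_quotient_topology)

lemma topspace_C_star [simp]:
  "topspace (C_star :: ('b::topological_space \<Rightarrow> real) set topology) = const_class ` continuous_functions"
  by (simp add: C_star_def topspace_quotient_topology)

text \<open>The preimage of the set in the space of functions is the union of all translates of the
  neighbourhood by constants.\<close>

lemma openin_C_star_nbhd:
  assumes f: "f \<in> continuous_functions" and K: "compact K" and e: "0 < e"
  shows "openin C_star (const_class ` {g \<in> continuous_functions. \<forall>x\<in>K. \<bar>g x - f x\<bar> < e})"
    (is "openin C_star (const_class ` ?N)")
proof -
  let ?B = "\<lambda>k. {g \<in> continuous_functions. \<forall>x\<in>K. \<bar>g x - (f x + k)\<bar> < e}"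
  have shift: "(\<lambda>x. g x + k) \<in> continuous_functions" if "g \<in> continuous_functions" for g :: "'a \<Rightarrow> real" and k
    using that unfolding continuous_functions_def by (auto intro!: continuous_intros)
  have "{h \<in> topspace compact_convergence_topology. const_class h \<in> const_class ` ?N} = (\<Union>k. ?B k)"
  proof (intro equalityI subsetI)
    fix h assume "h \<in> {h \<in> topspace compact_convergence_topology. const_class h \<in> const_class ` ?N}"
    then obtain g where h: "h \<in> continuous_functions" and g: "g \<in> ?N" "const_class h = const_class g" by auto
    then obtain k where "\<forall>x. g x = h x + k" using const_class_eq_iff[OF h] by blast
    then have "h \<in> ?B (- k)" using h g(1) by (auto simp: algebra_simps)
    then show "h \<in> (\<Union>k. ?B k)" by blast
  next
    fix h assume "h \<in> (\<Union>k. ?B k)"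
    then obtain k where h: "h \<in> continuous_functions" "\<forall>x\<in>K. \<bar>h x - (f x + k)\<bar> < e" by blast
    let ?g = "\<lambda>x. h x + (- k)"
    have "?g \<in> ?N" using h shift[OF h(1), of "- k"] by (simp add: algebra_simps)
    moreover have "const_class h = const_class ?g"
      using const_class_eq_iff[OF h(1) shift[OF h(1)]] by blast
    ultimately show "h \<in> {h \<in> topspace compact_convergence_topology. const_class h \<in> const_class ` ?N}"
      using h(1) by auto
  qed
  moreover have "openin compact_convergence_topology (?B k)" for k
    unfolding compact_convergence_topology_def
    by (intro topology_generated_by_Basis CollectI exI conjI) (rule refl shift[OF f] K e)+
  ultimately show ?thesis
    unfolding C_star_def openin_quotient_topology by auto
qed

section \<open>The boundary classes and their coordinates\<close>

lemma max_close:
  fixes a b c d e :: real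
  assumes "\<bar>a - c\<bar> < e" "\<bar>b - d\<bar> < e"
  shows "\<bar>max a b - max c d\<bar> < e"
  using assms by (auto simp: max_def abs_less_iff)

text \<open>Read \<open>fz\<close>, \<open>gz\<close> as values of functions \<open>f\<close>, \<open>g\<close> at a point \<open>z\<close> of interest, and \<open>x\<close>, \<open>w\<close> as points
  far out on two rays where \<open>f\<close> and a second function are very negative. The value of the second maximum at
  \<open>(x, w)\<close> bounds \<open>gw\<close> from above, so \<open>gw\<close> is irrelevant for the maximum at \<open>(z, w)\<close>.\<close>

lemma max_isolates_left:
  fixes e k T :: real
  assumes "\<bar>max gz gw - max fz fw - k\<bar> \<le> e" and "\<bar>max gx gw - max fx fw - k\<bar> \<le> e"
    and "fx \<le> - T" "fw \<le> - T" "2 * e - T < fz"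
  shows "\<bar>gz - fz - k\<bar> \<le> e"
proof -
  have "max fx fw \<le> - T" using assms by simp
  then have "max gx gw \<le> k + e - T" using assms(2) by linarith
  then have gw: "gw \<le> k + e - T" by simp
  have "0 \<le> e" using assms(1) by linarith
  then have fz: "max fz fw = fz" using assms(4,5) by simp
  have "fz + k - e \<le> max gz gw" using assms(1) fz by linarith
  then have "max gz gw = gz" using gw assms(5) by linarith
  with assms(1) fz show ?thesis by simp
qed

definition max_busemann :: "(real \<Rightarrow> 'a::metric_space) set \<Rightarrow> 'a \<Rightarrow> (real \<Rightarrow> 'a) set \<Rightarrow> 'a \<Rightarrow> real \<Rightarrow> 'a \<times> 'a \<Rightarrow> real" where
  "max_busemann \<xi> p \<xi>' p' r = (\<lambda>(z, z'). max (busemann \<xi> p z) (busemann \<xi>' p' z' + r))"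

lemma topspace_max_boundary_reg:
  "topspace (subtopology C_star (max_boundary_reg :: ('a::metric_space \<times> 'a \<Rightarrow> real) set set)) = max_boundary_reg"
proof -
  have "max_boundary_reg \<subseteq> topspace (C_star :: ('a \<times> 'a \<Rightarrow> real) set topology)"
    unfolding max_boundary_reg_def max_boundary_def max_compactification_def
    using closure_of_subset_topspace[of C_star] by blast
  then show ?thesis by (simp add: Int_absorb1)
qed

context
  assumes cat: "CAT_neg1 (UNIV :: 'a::heine_borel set)"
begin

lemma cone_nbhd_iff:
  fixes \<xi> :: "(real \<Rightarrow> 'a) set"
  shows "\<xi> \<in> cone_nbhd c r e \<longleftrightarrow> \<xi> \<in> ideal_boundary \<and> dist (ray_from (c 0) \<xi> r) (c r) < e"
  unfolding cone_nbhd_def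
  using ray_from_unique[OF cat, of \<xi>] ray_from_in[OF cat, of \<xi> "c 0"] by (auto; metis)

lemma topspace_ideal_boundary [simp]:
  "topspace (ideal_boundary_topology :: (real \<Rightarrow> 'a) set topology) = ideal_boundary"
proof -
  have "\<xi> \<in> \<Union>{cone_nbhd c r e | c r e. c \<in> geodesic_rays \<and> 0 < r \<and> 0 < e}"
    if \<xi>: "\<xi> \<in> ideal_boundary" for \<xi> :: "(real \<Rightarrow> 'a) set"
  proof (rule UnionI)
    show "\<xi> \<in> cone_nbhd (ray_from undefined \<xi>) 1 1"
      using \<xi> ray_from_in(2)[OF cat \<xi>] by (simp add: cone_nbhd_iff)
    show "cone_nbhd (ray_from undefined \<xi>) 1 1
        \<in> {cone_nbhd c r e | c r e. c \<in> geodesic_rays \<and> 0 < r \<and> 0 < e}"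
      by (intro CollectI exI conjI) (rule refl ray_from_ray[OF cat \<xi>] zero_less_one)+
  qed
  then show ?thesis
    unfolding ideal_boundary_topology_def by (auto simp: cone_nbhd_iff)
qed

text \<open>By the uniform convergence in \<open>busemann_uniform\<close> it suffices that the rays are close at a single
  late time, which is a neighbourhood of the cone topology.\<close>

lemma busemann_continuous_in_boundary:
  fixes \<xi> :: "(real \<Rightarrow> 'a) set"
  assumes \<xi>: "\<xi> \<in> ideal_boundary" and e: "0 < e"
  shows "\<exists>U. openin ideal_boundary_topology U \<and> \<xi> \<in> U \<and>
    (\<forall>\<eta>\<in>U. \<forall>z\<in>cball p R. \<bar>busemann \<eta> p z - busemann \<xi> p z\<bar> < e)"
proof -
  obtain t where t: "0 < t" "2 * exp (2 * R) * exp (- t) < e / 3"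
    using ex_exp_uminus_less[of "e / 3" "2 * exp (2 * R)"] e by (metis divide_pos_pos zero_less_numeral)
  let ?U = "cone_nbhd (ray_from p \<xi>) t (e / 3)"
  have "openin ideal_boundary_topology ?U"
    unfolding ideal_boundary_topology_def
    by (intro topology_generated_by_Basis CollectI exI conjI, rule refl)
      (use ray_from_ray[OF cat \<xi>] t e in auto)
  moreover have "\<xi> \<in> ?U" using \<xi> e ray_from_in(2)[OF cat \<xi>] by (simp add: cone_nbhd_iff)
  moreover have "\<bar>busemann \<eta> p z - busemann \<xi> p z\<bar> < e" if "\<eta> \<in> ?U" "z \<in> cball p R" for \<eta> z
  proof -
    have \<eta>: "\<eta> \<in> ideal_boundary" "dist (ray_from p \<eta> t) (ray_from p \<xi> t) < e / 3"
      using that(1) ray_from_in(2)[OF cat \<xi>, of p] by (auto simp: cone_nbhd_iff)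
    have z: "dist z p \<le> R" using that(2) by (simp add: dist_commute)
    show ?thesis
      using busemann_uniform[OF cat \<eta>(1) _ z, of t] busemann_uniform[OF cat \<xi> _ z, of t] t \<eta>(2)
        abs_dist_diff_le[of "ray_from p \<eta> t" z "ray_from p \<xi> t"] dist_commute[of "ray_from p \<eta> t" z]
      by linarith
  qed
  ultimately show ?thesis by blast
qed

lemma max_busemann_continuous:
  fixes \<xi> \<xi>' :: "(real \<Rightarrow> 'a) set"
  assumes \<xi>: "\<xi> \<in> ideal_boundary" and \<xi>': "\<xi>' \<in> ideal_boundary"
  shows "max_busemann \<xi> p \<xi>' p' r \<in> continuous_functions"
  unfolding continuous_functions_def max_busemann_def case_prod_unfold
  by (auto intro!: continuous_intros continuous_on_compose2[OF continuous_on_busemann[OF cat \<xi>]]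
      continuous_on_compose2[OF continuous_on_busemann[OF cat \<xi>']])

lemma max_busemann_class_eq: "max_busemann_class \<xi> p \<xi>' p' = const_class (max_busemann \<xi> p \<xi>' p' 0)"
  by (simp add: max_busemann_class_def max_busemann_def)

text \<open>A class depends only on its ideal points and the third coordinate; the representative on the
  right has fixed base points.\<close>

lemma max_busemann_class_normalize:
  fixes \<xi> \<xi>' :: "(real \<Rightarrow> 'a) set"
  assumes \<xi>: "\<xi> \<in> ideal_boundary" and \<xi>': "\<xi>' \<in> ideal_boundary"
  shows "max_busemann_class \<xi> p \<xi>' p'
    = const_class (max_busemann \<xi> b' \<xi>' b (busemann \<xi>' p' b - busemann \<xi> p b'))"
proof -
  have "max_busemann \<xi> b' \<xi>' b (busemann \<xi>' p' b - busemann \<xi> p b') x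
      = max_busemann \<xi> p \<xi>' p' 0 x + (- busemann \<xi> p b')" for x
    using busemann_change_base[OF cat \<xi>, of b' _ p] busemann_change_base[OF cat \<xi>', of b _ p']
    by (auto simp: max_busemann_def split: prod.split)
  then show ?thesis
    unfolding max_busemann_class_eq
    using const_class_eq_iff[OF max_busemann_continuous[OF \<xi> \<xi>'] max_busemann_continuous[OF \<xi> \<xi>']] by blast
qed

text \<open>Base points on the rays from \<open>b\<close> and \<open>b'\<close> suffice: one of the two Busemann functions is shifted
  up, depending on the sign of \<open>r\<close>.\<close>

lemma busemann_difference_surj:
  fixes \<xi> \<xi>' :: "(real \<Rightarrow> 'a) set"
  assumes \<xi>: "\<xi> \<in> ideal_boundary" and \<xi>': "\<xi>' \<in> ideal_boundary"
  shows "\<exists>p p'. busemann \<xi>' p' b - busemann \<xi> p b' = r"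
proof -
  have shift: "busemann \<eta> (ray_from x \<eta> t) x = t" if "\<eta> \<in> ideal_boundary" "0 \<le> t"
    for \<eta> :: "(real \<Rightarrow> 'a) set" and x t
    using busemann_change_base[OF cat that(1), of "ray_from x \<eta> t" x x]
      busemann_along_ray[OF cat that, of x x] by simp
  have "busemann \<xi>' (ray_from b \<xi>' (max r 0)) b - busemann \<xi> (ray_from b' \<xi> (max (- r) 0)) b' = r"
    using shift[OF \<xi>', of "max r 0" b] shift[OF \<xi>, of "max (- r) 0" b'] by simp
  then show ?thesis by blast
qed

lemma busemann_along_own_ray:
  fixes \<xi> :: "(real \<Rightarrow> 'a) set"
  assumes \<xi>: "\<xi> \<in> ideal_boundary" and t: "0 \<le> t"
  shows "busemann \<xi> p (ray_from p \<xi> t) = - t"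
  using busemann_along_ray[OF cat \<xi> t, of p p] busemann_change_base[OF cat \<xi>, of p p p] by simp

text \<open>The class is the limit of \<open>iota_max\<close> at the points \<open>?u t\<close>. It is not in the image of \<open>iota_max\<close>
  because its representatives tend to \<open>-\<infinity>\<close> along these points, while a distance function is bounded below.\<close>

lemma max_busemann_class_in_max_boundary:
  fixes \<xi> \<xi>' :: "(real \<Rightarrow> 'a) set"
  assumes \<xi>: "\<xi> \<in> ideal_boundary" and \<xi>': "\<xi>' \<in> ideal_boundary"
  shows "max_busemann_class \<xi> p \<xi>' p' \<in> max_boundary"
proof -
  let ?f = "max_busemann \<xi> p \<xi>' p' 0"
  let ?u = "\<lambda>t. (ray_from p \<xi> t, ray_from p' \<xi>' t)"
  note f = max_busemann_continuous[OF \<xi> \<xi>', of p p' 0]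
  have dmax: "dmax u \<in> continuous_functions" for u :: "'a \<times> 'a"
    unfolding dmax_def continuous_functions_def by (auto intro!: continuous_intros)
  have "\<exists>u. iota_max u \<in> T" if T: "openin C_star T" "const_class ?f \<in> T" for T
  proof -
    let ?V = "{g \<in> topspace compact_convergence_topology. const_class g \<in> T}"
    have "openin compact_convergence_topology ?V"
      using T(1) unfolding C_star_def openin_quotient_topology by blast
    moreover have "?f \<in> ?V" using f T(2) by simp
    ultimately have "\<exists>K e. compact K \<and> 0 < e \<and> {g \<in> continuous_functions. \<forall>x\<in>K. \<bar>g x - ?f x\<bar> < e} \<subseteq> ?V"
      by (rule compact_convergence_nbhd_base)
    then obtain K e where K: "compact K" and e: "0 < e"
      and sub: "{g \<in> continuous_functions. \<forall>x\<in>K. \<bar>g x - ?f x\<bar> < e} \<subseteq> ?V"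
      by blast
    obtain R where R: "\<forall>x\<in>K. dist (p, p') x \<le> R"
      using compact_imp_bounded[OF K] bounded_any_center[of K "(p, p')"] by blast
    obtain t where t: "0 < t" "2 * exp (2 * R) * exp (- t) < e"
      using ex_exp_uminus_less[OF e, of "2 * exp (2 * R)"] by blast
    let ?g = "\<lambda>x. dmax (?u t) x + (- t)"
    have g: "?g \<in> continuous_functions"
      using dmax[of "?u t"] unfolding continuous_functions_def by (auto intro!: continuous_intros)
    have "\<bar>?g x - ?f x\<bar> < e" if x: "x \<in> K" for x
    proof -
      have d: "dist (fst x) p \<le> R" "dist (snd x) p' \<le> R"
        using R x dist_fst_le[of x "(p, p')"] dist_snd_le[of x "(p, p')"]
        by (auto simp: dist_commute intro: order_trans)
      have "\<bar>max (dist (fst x) (ray_from p \<xi> t) - t) (dist (snd x) (ray_from p' \<xi>' t) - t)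
          - max (busemann \<xi> p (fst x)) (busemann \<xi>' p' (snd x))\<bar> < e"
        using busemann_uniform[OF cat \<xi> _ d(1), of t] busemann_uniform[OF cat \<xi>' _ d(2), of t] t
        by (intro max_close) auto
      then show ?thesis
        unfolding max_busemann_def dmax_def case_prod_unfold
        by (simp add: dist_commute[of "fst x"] dist_commute[of "snd x"] max_diff_distrib_left)
    qed
    then have "?g \<in> ?V" using sub g by blast
    moreover have "const_class (dmax (?u t)) = const_class ?g"
      using const_class_eq_iff[OF dmax g] by blast
    ultimately have "iota_max (?u t) \<in> T" unfolding iota_max_def by simp
    then show ?thesis ..
  qed
  then have "const_class ?f \<in> max_compactification"
    unfolding max_compactification_def in_closure_of using f by auto
  moreover have "const_class ?f \<noteq> iota_max u" for u
  proof
    assume "const_class ?f = iota_max u"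
    then obtain k where k: "\<And>x. dmax u x = ?f x + k"
      unfolding iota_max_def const_class_eq_iff[OF f dmax] by blast
    have "0 \<le> dmax u (?u (\<bar>k\<bar> + 1))" by (simp add: dmax_def le_max_iff_disj)
    then show False
      unfolding k max_busemann_def
      using busemann_along_own_ray[OF \<xi>, of "\<bar>k\<bar> + 1" p] busemann_along_own_ray[OF \<xi>', of "\<bar>k\<bar> + 1" p']
      by simp
  qed
  ultimately show ?thesis unfolding max_boundary_def max_busemann_class_eq by blast
qed

lemma max_boundary_reg_eq:
  "max_boundary_reg = {max_busemann_class \<xi> p \<xi>' p' | (\<xi> :: (real \<Rightarrow> 'a) set) p \<xi>' p'.
     \<xi> \<in> ideal_boundary \<and> \<xi>' \<in> ideal_boundary}"
  unfolding max_boundary_reg_def using max_busemann_class_in_max_boundary by blast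

lemma max_busemann_separates:
  fixes \<xi> \<xi>' :: "(real \<Rightarrow> 'a) set"
  assumes \<xi>: "\<xi> \<in> ideal_boundary" and \<xi>': "\<xi>' \<in> ideal_boundary"
    and T: "0 \<le> T" "\<bar>busemann \<xi> p z\<bar> + 2 * e < T" "\<bar>busemann \<xi>' p' z\<bar> + 2 * e < T"
    and close: "\<And>x y. x \<in> {z, ray_from p \<xi> T} \<Longrightarrow> y \<in> {z, ray_from p' \<xi>' T} \<Longrightarrow>
      \<bar>max_busemann \<eta> q \<eta>' q' 0 (x, y) - max_busemann \<xi> p \<xi>' p' 0 (x, y) - k\<bar> \<le> e"
  shows "\<bar>busemann \<eta> q z - busemann \<xi> p z - k\<bar> \<le> e"
    and "\<bar>busemann \<eta>' q' z - busemann \<xi>' p' z - k\<bar> \<le> e"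
proof -
  note along = busemann_along_own_ray[OF \<xi> T(1), of p] busemann_along_own_ray[OF \<xi>' T(1), of p']
  have close': "\<bar>max (busemann \<eta> q x) (busemann \<eta>' q' y) - max (busemann \<xi> p x) (busemann \<xi>' p' y) - k\<bar> \<le> e"
    if "x \<in> {z, ray_from p \<xi> T}" "y \<in> {z, ray_from p' \<xi>' T}" for x y
    using close[OF that] by (simp add: max_busemann_def)
  show "\<bar>busemann \<eta> q z - busemann \<xi> p z - k\<bar> \<le> e"
    by (rule max_isolates_left[where T = T, OF close'[of z "ray_from p' \<xi>' T"]
          close'[of "ray_from p \<xi> T" "ray_from p' \<xi>' T"]])
      (use along T in auto)
  have close'': "\<bar>max (busemann \<eta>' q' y) (busemann \<eta> q x) - max (busemann \<xi>' p' y) (busemann \<xi> p x) - k\<bar> \<le> e"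
    if "x \<in> {z, ray_from p \<xi> T}" "y \<in> {z, ray_from p' \<xi>' T}" for x y
    using close'[OF that] by (simp add: max.commute)
  show "\<bar>busemann \<eta>' q' z - busemann \<xi>' p' z - k\<bar> \<le> e"
    by (rule max_isolates_left[where T = T, OF close''[of "ray_from p \<xi> T" z]
          close''[of "ray_from p \<xi> T" "ray_from p' \<xi>' T"]])
      (use along T in auto)
qed

lemma max_busemann_class_inj:
  fixes \<xi> \<xi>' \<eta> \<eta>' :: "(real \<Rightarrow> 'a) set"
  assumes \<xi>: "\<xi> \<in> ideal_boundary" and \<xi>': "\<xi>' \<in> ideal_boundary"
    and \<eta>: "\<eta> \<in> ideal_boundary" and \<eta>': "\<eta>' \<in> ideal_boundary"
    and eq: "max_busemann_class \<xi> p \<xi>' p' = max_busemann_class \<eta> q \<eta>' q'"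
  shows "\<eta> = \<xi>" "\<eta>' = \<xi>'"
    and "busemann \<eta>' q' b - busemann \<eta> q b' = busemann \<xi>' p' b - busemann \<xi> p b'"
proof -
  obtain k where k: "\<And>x. max_busemann \<eta> q \<eta>' q' 0 x = max_busemann \<xi> p \<xi>' p' 0 x + k"
    using eq const_class_eq_iff[OF max_busemann_continuous[OF \<xi> \<xi>'] max_busemann_continuous[OF \<eta> \<eta>']]
    unfolding max_busemann_class_eq by blast
  have "\<bar>busemann \<eta> q z - busemann \<xi> p z - k\<bar> \<le> 0 \<and> \<bar>busemann \<eta>' q' z - busemann \<xi>' p' z - k\<bar> \<le> 0" for z
    using max_busemann_separates[OF \<xi> \<xi>', of "\<bar>busemann \<xi> p z\<bar> + \<bar>busemann \<xi>' p' z\<bar> + 1" p z 0 p' \<eta> q \<eta>' q' k]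
    unfolding k by (auto simp: add_nonneg_nonneg)
  then have bus: "busemann \<eta> q z = busemann \<xi> p z + k" "busemann \<eta>' q' z = busemann \<xi>' p' z + k" for z
    by (simp_all add: algebra_simps)
  show "\<eta> = \<xi>" by (rule ideal_boundary_eqI[OF cat \<xi> \<eta> bus(1)])
  show "\<eta>' = \<xi>'" by (rule ideal_boundary_eqI[OF cat \<xi>' \<eta>' bus(2)])
  show "busemann \<eta>' q' b - busemann \<eta> q b' = busemann \<xi>' p' b - busemann \<xi> p b'" using bus by simp
qed

text \<open>Neighbourhoods of a class can be described by the two Busemann functions separately: closeness of
  the maxima on a compact set that contains one far point of each ray implies closeness of both functions on a
  ball, up to the same constant \<open>k\<close>.\<close>

lemma openin_max_boundary_regI:
  assumes A: "A \<subseteq> max_boundary_reg"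
    and loc: "\<And>\<xi> \<xi>' p p'. \<xi> \<in> ideal_boundary \<Longrightarrow> \<xi>' \<in> ideal_boundary \<Longrightarrow> max_busemann_class \<xi> p \<xi>' p' \<in> A \<Longrightarrow>
      \<exists>x R \<delta>. 0 < \<delta> \<and> (\<forall>\<eta>\<in>ideal_boundary. \<forall>\<eta>'\<in>ideal_boundary. \<forall>q q' k.
        (\<forall>z\<in>cball x R. \<bar>busemann \<eta> q z - busemann \<xi> p z - k\<bar> \<le> \<delta> \<and> \<bar>busemann \<eta>' q' z - busemann \<xi>' p' z - k\<bar> \<le> \<delta>)
        \<longrightarrow> max_busemann_class \<eta> q \<eta>' q' \<in> A)"
  shows "openin (subtopology C_star max_boundary_reg) (A :: ('a \<times> 'a \<Rightarrow> real) set set)"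
proof (subst openin_subopen, intro ballI)
  fix F assume F: "F \<in> A"
  with A have "F \<in> max_boundary_reg" by blast
  then obtain \<xi> \<xi>' p p' where \<xi>: "\<xi> \<in> ideal_boundary" and \<xi>': "\<xi>' \<in> ideal_boundary"
    and Feq: "F = max_busemann_class \<xi> p \<xi>' p'" unfolding max_boundary_reg_eq by blast
  obtain x R \<delta> where \<delta>: "0 < \<delta>" and near: "\<And>\<eta> \<eta>' q q' k. \<eta> \<in> ideal_boundary \<Longrightarrow> \<eta>' \<in> ideal_boundary \<Longrightarrow>
        \<forall>z\<in>cball x R. \<bar>busemann \<eta> q z - busemann \<xi> p z - k\<bar> \<le> \<delta> \<and> \<bar>busemann \<eta>' q' z - busemann \<xi>' p' z - k\<bar> \<le> \<delta>
        \<Longrightarrow> max_busemann_class \<eta> q \<eta>' q' \<in> A"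
    using loc[OF \<xi> \<xi>' F[unfolded Feq]] by blast
  \<comment> \<open>Late enough that both Busemann functions exceed \<open>2 * \<delta> - T\<close> on the whole ball.\<close>
  define T where "T = \<bar>R\<bar> + dist x p + dist x p' + 2 * \<delta> + 1"
  let ?K = "insert (ray_from p \<xi> T) (cball x R) \<times> insert (ray_from p' \<xi>' T) (cball x R)"
  let ?f = "max_busemann \<xi> p \<xi>' p' 0"
  let ?N = "{g \<in> continuous_functions. \<forall>y\<in>?K. \<bar>g y - ?f y\<bar> < \<delta>}"
  let ?U = "const_class ` ?N \<inter> max_boundary_reg"
  note f = max_busemann_continuous[OF \<xi> \<xi>', of p p' 0]
  have T: "0 \<le> T" "\<bar>busemann \<xi> p z\<bar> + 2 * \<delta> < T" "\<bar>busemann \<xi>' p' z\<bar> + 2 * \<delta> < T" if "z \<in> cball x R" for z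
  proof -
    have z: "dist z x \<le> R" using that by (simp add: dist_commute)
    show "0 \<le> T" using \<delta> by (simp add: T_def)
    show "\<bar>busemann \<xi> p z\<bar> + 2 * \<delta> < T"
      using abs_busemann_le[OF cat \<xi>, of p z] z dist_triangle[of z p x] zero_le_dist[of x p']
      unfolding T_def by linarith
    show "\<bar>busemann \<xi>' p' z\<bar> + 2 * \<delta> < T"
      using abs_busemann_le[OF cat \<xi>', of p' z] z dist_triangle[of z p' x] zero_le_dist[of x p]
      unfolding T_def by linarith
  qed
  show "\<exists>T. openin (subtopology C_star max_boundary_reg) T \<and> F \<in> T \<and> T \<subseteq> A"
  proof (intro exI conjI)
    have "openin C_star (const_class ` ?N)"
      by (rule openin_C_star_nbhd[OF f _ \<delta>]) (intro compact_Times compact_insert compact_cball)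
    then show "openin (subtopology C_star max_boundary_reg) ?U" by (rule openin_subtopology_Int)
    have "?f \<in> ?N" using f \<delta> by simp
    then show "F \<in> ?U" using F A unfolding Feq max_busemann_class_eq by blast
    show "?U \<subseteq> A"
    proof
      fix G assume G: "G \<in> ?U"
      then have "G \<in> max_boundary_reg" by blast
      then obtain \<eta> \<eta>' q q' where \<eta>: "\<eta> \<in> ideal_boundary" and \<eta>': "\<eta>' \<in> ideal_boundary"
        and Geq: "G = max_busemann_class \<eta> q \<eta>' q'" unfolding max_boundary_reg_eq by blast
      from G obtain g where g: "g \<in> ?N" "G = const_class g" by blast
      then have "g \<in> continuous_functions" by simp
      moreover have "const_class g = const_class (max_busemann \<eta> q \<eta>' q' 0)"
        using g(2) unfolding Geq max_busemann_class_eq by (rule sym)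
      ultimately obtain k where k: "\<forall>y. max_busemann \<eta> q \<eta>' q' 0 y = g y + k"
        using const_class_eq_iff[OF _ max_busemann_continuous[OF \<eta> \<eta>'], of g] by blast
      have close: "\<bar>max_busemann \<eta> q \<eta>' q' 0 y - ?f y - k\<bar> \<le> \<delta>" if "y \<in> ?K" for y
      proof -
        have "\<bar>g y - ?f y\<bar> < \<delta>" using g(1) that by blast
        then show ?thesis using k[rule_format, of y] by linarith
      qed
      have "\<bar>busemann \<eta> q z - busemann \<xi> p z - k\<bar> \<le> \<delta> \<and> \<bar>busemann \<eta>' q' z - busemann \<xi>' p' z - k\<bar> \<le> \<delta>"
        if z: "z \<in> cball x R" for z
      proof -
        have "\<bar>max_busemann \<eta> q \<eta>' q' 0 (u, v) - ?f (u, v) - k\<bar> \<le> \<delta>"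
          if "u \<in> {z, ray_from p \<xi> T}" "v \<in> {z, ray_from p' \<xi>' T}" for u v
          by (rule close) (use that z in blast)
        from max_busemann_separates[OF \<xi> \<xi>' T[OF z] this] show ?thesis by blast
      qed
      then show "G \<in> A" unfolding Geq by (intro near[OF \<eta> \<eta>'] ballI)
    qed
  qed
qed

text \<open>This links uniform closeness of Busemann functions to the cone topology, with the base point of
  the cone neighbourhood arbitrary.\<close>

lemma ray_from_locally_close:
  fixes \<xi> :: "(real \<Rightarrow> 'a) set"
  assumes \<xi>: "\<xi> \<in> cone_nbhd c r e" and r: "0 < r"
  shows "\<exists>\<delta>>0. \<forall>\<eta>\<in>ideal_boundary. \<forall>q k.
    (\<forall>z\<in>cball (c 0) r. \<bar>busemann \<eta> q z - busemann \<xi> p z - k\<bar> \<le> \<delta>) \<longrightarrow> \<eta> \<in> cone_nbhd c r e"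
proof -
  have \<xi>B: "\<xi> \<in> ideal_boundary" using \<xi> by (simp add: cone_nbhd_iff)
  define d where "d = e - dist (ray_from (c 0) \<xi> r) (c r)"
  have d: "0 < d" using \<xi> by (simp add: d_def cone_nbhd_iff)
  \<comment> \<open>Any \<open>\<delta> > 0\<close> with \<open>exp (2 * \<delta>) < cosh (d / 2)\<close> would do.\<close>
  define \<delta> where "\<delta> = ln (cosh (d / 2)) / 4"
  have cd: "1 < cosh (d / 2)" using cosh_real_nonneg_less_iff[of 0 "d / 2"] d by simp
  then have \<delta>: "0 < \<delta>" "exp (2 * \<delta>) < cosh (d / 2)"
  proof -
    show "0 < \<delta>" using cd by (simp add: \<delta>_def)
    have "exp (2 * \<delta>) < exp (4 * \<delta>)" using \<open>0 < \<delta>\<close> by simp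
    also have "\<dots> = cosh (d / 2)" using cd by (simp add: \<delta>_def)
    finally show "exp (2 * \<delta>) < cosh (d / 2)" .
  qed
  have "\<eta> \<in> cone_nbhd c r e"
    if \<eta>: "\<eta> \<in> ideal_boundary" and close: "\<forall>z\<in>cball (c 0) r. \<bar>busemann \<eta> q z - busemann \<xi> p z - k\<bar> \<le> \<delta>"
    for \<eta> q k
  proof -
    let ?x = "ray_from (c 0) \<xi> r" and ?y = "ray_from (c 0) \<eta> r"
    have "dist (c 0) ?x = r"
      using geodesic_rayD[OF ray_from_ray[OF cat \<xi>B], of 0 r "c 0"] ray_from_in(2)[OF cat \<xi>B, of "c 0"] r by simp
    then have "cosh (dist ?y ?x / 2) \<le> exp (2 * \<delta>)"
      using close r by (intro ray_from_close[OF cat \<xi>B \<eta>, of r q "c 0" p k]) auto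
    then have "cosh (dist ?y ?x / 2) < cosh (d / 2)" using \<delta> by linarith
    then have "dist ?y ?x < d"
      using cosh_real_nonneg_less_iff[of "dist ?y ?x / 2" "d / 2"] d by simp
    then have "dist ?y (c r) < e"
      using dist_triangle[of ?y "c r" ?x] by (simp add: d_def)
    with \<eta> show ?thesis by (simp add: cone_nbhd_iff)
  qed
  with \<delta>(1) show ?thesis by blast
qed

end

section \<open>The coordinate homeomorphism\<close>

context
  assumes cat: "CAT_neg1 (UNIV :: 'a::heine_borel set)"
begin

lemma continuous_map_into_ideal_boundary:
  assumes "\<And>F. F \<in> topspace X \<Longrightarrow> h F \<in> (ideal_boundary :: (real \<Rightarrow> 'a) set set)"
    and "\<And>c r e. c \<in> geodesic_rays \<Longrightarrow> 0 < r \<Longrightarrow> 0 < e \<Longrightarrow> openin X {F \<in> topspace X. h F \<in> cone_nbhd c r e}"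
  shows "continuous_map X ideal_boundary_topology h"
  unfolding ideal_boundary_topology_def
proof (rule continuous_on_generated_topo)
  show "h ` topspace X \<subseteq> \<Union>{cone_nbhd c r e | c r e. c \<in> geodesic_rays \<and> 0 < r \<and> 0 < e}"
    using assms(1) topspace_ideal_boundary[OF cat] unfolding ideal_boundary_topology_def by auto
  fix U :: "(real \<Rightarrow> 'a) set set"
  assume "U \<in> {cone_nbhd c r e | c r e. c \<in> geodesic_rays \<and> 0 < r \<and> 0 < e}"
  then obtain c r e where "U = cone_nbhd c r e" "c \<in> geodesic_rays" "0 < r" "0 < e" by blast
  moreover have "h -` U \<inter> topspace X = {F \<in> topspace X. h F \<in> U}" by auto
  ultimately show "openin X (h -` U \<inter> topspace X)" using assms(2) by simp
qed

lemma continuous_map_coordinates: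
  fixes \<phi> :: "('a \<times> 'a \<Rightarrow> real) set \<Rightarrow> (real \<Rightarrow> 'a) set \<times> (real \<Rightarrow> 'a) set \<times> real"
  assumes \<phi>: "\<And>\<xi> \<xi>' p p'. \<xi> \<in> ideal_boundary \<Longrightarrow> \<xi>' \<in> ideal_boundary \<Longrightarrow>
    \<phi> (max_busemann_class \<xi> p \<xi>' p') = (\<xi>, \<xi>', busemann \<xi>' p' b - busemann \<xi> p b')"
  shows "continuous_map (subtopology C_star max_boundary_reg)
    (prod_topology ideal_boundary_topology (prod_topology ideal_boundary_topology euclideanreal)) \<phi>"
proof -
  let ?X = "subtopology C_star (max_boundary_reg :: ('a \<times> 'a \<Rightarrow> real) set set)"
  note top = topspace_max_boundary_reg
  note reg = max_boundary_reg_eq[OF cat]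
  have in_reg: "max_busemann_class \<xi> p \<xi>' p' \<in> max_boundary_reg"
    if "\<xi> \<in> ideal_boundary" "\<xi>' \<in> ideal_boundary" for \<xi> \<xi>' :: "(real \<Rightarrow> 'a) set" and p p'
    unfolding reg using that by blast
  have "continuous_map ?X ideal_boundary_topology (fst \<circ> \<phi>)"
  proof (rule continuous_map_into_ideal_boundary)
    fix F assume "F \<in> topspace ?X"
    then show "(fst \<circ> \<phi>) F \<in> ideal_boundary" unfolding top reg using \<phi> by auto
  next
    fix c :: "real \<Rightarrow> 'a" and r e :: real assume c: "c \<in> geodesic_rays" "0 < r" "0 < e"
    show "openin ?X {F \<in> topspace ?X. (fst \<circ> \<phi>) F \<in> cone_nbhd c r e}"
      unfolding top
    proof (rule openin_max_boundary_regI[OF cat], goal_cases)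
      case (2 \<xi> \<xi>' p p')
      then have "\<xi> \<in> cone_nbhd c r e" using \<phi> by simp
      then obtain \<delta> where \<delta>: "0 < \<delta>" and near: "\<And>\<eta> q k. \<eta> \<in> ideal_boundary \<Longrightarrow>
          \<forall>z\<in>cball (c 0) r. \<bar>busemann \<eta> q z - busemann \<xi> p z - k\<bar> \<le> \<delta> \<Longrightarrow> \<eta> \<in> cone_nbhd c r e"
        using ray_from_locally_close[OF cat _ c(2)] by metis
      have "max_busemann_class \<eta> q \<eta>' q' \<in> {F \<in> max_boundary_reg. (fst \<circ> \<phi>) F \<in> cone_nbhd c r e}"
        if \<eta>: "\<eta> \<in> ideal_boundary" "\<eta>' \<in> ideal_boundary"
          and close: "\<forall>z\<in>cball (c 0) r. \<bar>busemann \<eta> q z - busemann \<xi> p z - k\<bar> \<le> \<delta>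
            \<and> \<bar>busemann \<eta>' q' z - busemann \<xi>' p' z - k\<bar> \<le> \<delta>" for \<eta> \<eta>' q q' k
        using near[of \<eta> q k] close \<phi>[OF \<eta>] in_reg[OF \<eta>] \<eta> by simp
      then show ?case using \<delta> by (intro exI[of _ "c 0"] exI[of _ r] exI[of _ \<delta>]) auto
    qed auto
  qed
  moreover have "continuous_map ?X ideal_boundary_topology (fst \<circ> (snd \<circ> \<phi>))"
  proof (rule continuous_map_into_ideal_boundary)
    fix F assume "F \<in> topspace ?X"
    then show "(fst \<circ> (snd \<circ> \<phi>)) F \<in> ideal_boundary" unfolding top reg using \<phi> by auto
  next
    fix c :: "real \<Rightarrow> 'a" and r e :: real assume c: "c \<in> geodesic_rays" "0 < r" "0 < e"
    show "openin ?X {F \<in> topspace ?X. (fst \<circ> (snd \<circ> \<phi>)) F \<in> cone_nbhd c r e}"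
      unfolding top
    proof (rule openin_max_boundary_regI[OF cat], goal_cases)
      case (2 \<xi> \<xi>' p p')
      then have "\<xi>' \<in> cone_nbhd c r e" using \<phi> by simp
      then obtain \<delta> where \<delta>: "0 < \<delta>" and near: "\<And>\<eta> q k. \<eta> \<in> ideal_boundary \<Longrightarrow>
          \<forall>z\<in>cball (c 0) r. \<bar>busemann \<eta> q z - busemann \<xi>' p' z - k\<bar> \<le> \<delta> \<Longrightarrow> \<eta> \<in> cone_nbhd c r e"
        using ray_from_locally_close[OF cat _ c(2)] by metis
      have "max_busemann_class \<eta> q \<eta>' q' \<in> {F \<in> max_boundary_reg. (fst \<circ> (snd \<circ> \<phi>)) F \<in> cone_nbhd c r e}"
        if \<eta>: "\<eta> \<in> ideal_boundary" "\<eta>' \<in> ideal_boundary"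
          and close: "\<forall>z\<in>cball (c 0) r. \<bar>busemann \<eta> q z - busemann \<xi> p z - k\<bar> \<le> \<delta>
            \<and> \<bar>busemann \<eta>' q' z - busemann \<xi>' p' z - k\<bar> \<le> \<delta>" for \<eta> \<eta>' q q' k
        using near[of \<eta>' q' k] close \<phi>[OF \<eta>] in_reg[OF \<eta>] \<eta> by simp
      then show ?case using \<delta> by (intro exI[of _ "c 0"] exI[of _ r] exI[of _ \<delta>]) auto
    qed auto
  qed
  moreover have "continuous_map ?X euclideanreal (snd \<circ> (snd \<circ> \<phi>))"
    unfolding continuous_map_def
  proof (intro conjI allI impI)
    fix U :: "real set" assume "openin euclideanreal U"
    then have U: "open U" by simp
    show "openin ?X {F \<in> topspace ?X. (snd \<circ> (snd \<circ> \<phi>)) F \<in> U}"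
      unfolding top
    proof (rule openin_max_boundary_regI[OF cat], goal_cases)
      case (2 \<xi> \<xi>' p p')
      then have "busemann \<xi>' p' b - busemann \<xi> p b' \<in> U" using \<phi> by simp
      then obtain e where e: "0 < e" "\<And>y. \<bar>y - (busemann \<xi>' p' b - busemann \<xi> p b')\<bar> < e \<Longrightarrow> y \<in> U"
        using U unfolding open_dist dist_real_def by blast
      have "max_busemann_class \<eta> q \<eta>' q' \<in> {F \<in> max_boundary_reg. (snd \<circ> (snd \<circ> \<phi>)) F \<in> U}"
        if \<eta>: "\<eta> \<in> ideal_boundary" "\<eta>' \<in> ideal_boundary"
          and close: "\<forall>z\<in>cball b (dist b b'). \<bar>busemann \<eta> q z - busemann \<xi> p z - k\<bar> \<le> e / 3
            \<and> \<bar>busemann \<eta>' q' z - busemann \<xi>' p' z - k\<bar> \<le> e / 3" for \<eta> \<eta>' q q' k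
      proof -
        have "\<bar>busemann \<eta> q b' - busemann \<xi> p b' - k\<bar> \<le> e / 3" "\<bar>busemann \<eta>' q' b - busemann \<xi>' p' b - k\<bar> \<le> e / 3"
          using close by simp_all
        then have "\<bar>(busemann \<eta>' q' b - busemann \<eta> q b') - (busemann \<xi>' p' b - busemann \<xi> p b')\<bar> < e"
          using e(1) by linarith
        then show ?thesis using e(2) \<phi>[OF \<eta>] in_reg[OF \<eta>] by simp
      qed
      then show ?case using e(1) by (intro exI[of _ b] exI[of _ "dist b b'"] exI[of _ "e / 3"]) auto
    qed auto
  qed auto
  ultimately show ?thesis by (simp add: continuous_map_pairwise)
qed

lemma continuous_map_max_busemann:
  "continuous_map
    (prod_topology ideal_boundary_topology (prod_topology ideal_boundary_topology euclideanreal))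
    (C_star :: ('a \<times> 'a \<Rightarrow> real) set topology)
    (\<lambda>(\<xi>, \<xi>', r). const_class (max_busemann \<xi> p \<xi>' p' r))"
proof -
  let ?Y = "prod_topology ideal_boundary_topology (prod_topology ideal_boundary_topology euclideanreal)
    :: ((real \<Rightarrow> 'a) set \<times> (real \<Rightarrow> 'a) set \<times> real) topology"
  let ?F = "\<lambda>(\<xi>, \<xi>', r). max_busemann \<xi> p \<xi>' p' r"
  have "continuous_map ?Y compact_convergence_topology ?F"
  proof (rule continuous_map_compact_convergenceI)
    fix y assume "y \<in> topspace ?Y"
    then show "?F y \<in> continuous_functions"
      using max_busemann_continuous[OF cat] topspace_ideal_boundary[OF cat] by auto
  next
    fix y :: "(real \<Rightarrow> 'a) set \<times> (real \<Rightarrow> 'a) set \<times> real" and K :: "('a \<times> 'a) set" and e :: real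
    assume y: "y \<in> topspace ?Y" and K: "compact K" and e: "0 < e"
    obtain \<xi> \<xi>' r where yeq: "y = (\<xi>, \<xi>', r)" by (cases y)
    with y have \<xi>: "\<xi> \<in> ideal_boundary" and \<xi>': "\<xi>' \<in> ideal_boundary"
      using topspace_ideal_boundary[OF cat] by auto
    obtain R where R: "\<forall>x\<in>K. dist (p, p') x \<le> R"
      using compact_imp_bounded[OF K] bounded_any_center[of K "(p, p')"] by blast
    obtain U where U: "openin ideal_boundary_topology U" "\<xi> \<in> U"
      "\<And>\<eta> z. \<eta> \<in> U \<Longrightarrow> z \<in> cball p R \<Longrightarrow> \<bar>busemann \<eta> p z - busemann \<xi> p z\<bar> < e"
      using busemann_continuous_in_boundary[OF cat \<xi> e, of p R] by blast
    obtain V where V: "openin ideal_boundary_topology V" "\<xi>' \<in> V"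
      "\<And>\<eta> z. \<eta> \<in> V \<Longrightarrow> z \<in> cball p' R \<Longrightarrow> \<bar>busemann \<eta> p' z - busemann \<xi>' p' z\<bar> < e / 2"
      using busemann_continuous_in_boundary[OF cat \<xi>' half_gt_zero[OF e], of p' R] by blast
    let ?W = "U \<times> V \<times> ball r (e / 2)"
    have "openin ?Y ?W" using U(1) V(1) by (simp add: openin_prod_Times_iff)
    moreover have "y \<in> ?W" using U(2) V(2) e yeq by simp
    moreover have "\<bar>?F w x - ?F y x\<bar> < e" if w: "w \<in> ?W" and x: "x \<in> K" for w x
    proof -
      obtain \<eta> \<eta>' s where weq: "w = (\<eta>, \<eta>', s)" by (cases w)
      have d: "fst x \<in> cball p R" "snd x \<in> cball p' R"
        using R x dist_fst_le[of "(p, p')" x] dist_snd_le[of "(p, p')" x] by (auto intro: order_trans)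
      have "\<bar>busemann \<eta>' p' (snd x) - busemann \<xi>' p' (snd x)\<bar> < e / 2" "\<bar>s - r\<bar> < e / 2"
        using V(3)[OF _ d(2)] w weq by (auto simp: dist_real_def abs_minus_commute)
      then have "\<bar>(busemann \<eta>' p' (snd x) + s) - (busemann \<xi>' p' (snd x) + r)\<bar> < e" by linarith
      moreover have "\<bar>busemann \<eta> p (fst x) - busemann \<xi> p (fst x)\<bar> < e"
        using U(3)[OF _ d(1)] w weq by auto
      ultimately show ?thesis
        unfolding yeq weq by (auto simp: max_busemann_def case_prod_unfold intro: max_close)
    qed
    ultimately show "\<exists>W. openin ?Y W \<and> y \<in> W \<and> (\<forall>w\<in>W. \<forall>x\<in>K. \<bar>?F w x - ?F y x\<bar> < e)" by blast
  qed
  from continuous_map_compose[OF this continuous_map_quotient_topology]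
  show ?thesis by (simp add: C_star_def comp_def case_prod_unfold)
qed

end

theorem proposition3:
  fixes b b' :: "'a::heine_borel"
  assumes "CAT_neg1 (UNIV :: 'a set)"
    and "\<not> compact (UNIV :: 'a set)"
  shows "\<exists>\<phi> :: ('a \<times> 'a \<Rightarrow> real) set \<Rightarrow> (real \<Rightarrow> 'a) set \<times> (real \<Rightarrow> 'a) set \<times> real.
    (\<forall>p p'. \<forall>\<xi>\<in>ideal_boundary. \<forall>\<xi>'\<in>ideal_boundary.
       max_busemann_class \<xi> p \<xi>' p' \<in> max_boundary_reg \<longrightarrow>
       \<phi> (max_busemann_class \<xi> p \<xi>' p') = (\<xi>, \<xi>', busemann \<xi>' p' b - busemann \<xi> p b')) \<and>
    homeomorphic_map (subtopology C_star max_boundary_reg)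
      (prod_topology ideal_boundary_topology (prod_topology ideal_boundary_topology euclideanreal))
      \<phi>"
proof -
  note cat = assms(1)
  let ?I = "ideal_boundary :: (real \<Rightarrow> 'a) set set"
  let ?X = "subtopology C_star (max_boundary_reg :: ('a \<times> 'a \<Rightarrow> real) set set)"
  let ?Y = "prod_topology ideal_boundary_topology (prod_topology ideal_boundary_topology euclideanreal)
    :: ((real \<Rightarrow> 'a) set \<times> (real \<Rightarrow> 'a) set \<times> real) topology"
  define \<psi> :: "(real \<Rightarrow> 'a) set \<times> (real \<Rightarrow> 'a) set \<times> real \<Rightarrow> ('a \<times> 'a \<Rightarrow> real) set"
    where "\<psi> = (\<lambda>(\<xi>, \<xi>', r). const_class (max_busemann \<xi> b' \<xi>' b r))"
  define \<phi> where "\<phi> = inv_into (?I \<times> ?I \<times> UNIV) \<psi>"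
  have \<psi>: "\<psi> (\<xi>, \<xi>', busemann \<xi>' p' b - busemann \<xi> p b') = max_busemann_class \<xi> p \<xi>' p'"
    if "\<xi> \<in> ?I" "\<xi>' \<in> ?I" for \<xi> \<xi>' p p'
    using max_busemann_class_normalize[OF cat that] by (simp add: \<psi>_def)
  have surj: "\<exists>p p'. r = busemann \<xi>' p' b - busemann \<xi> p b'" if "\<xi> \<in> ?I" "\<xi>' \<in> ?I" for \<xi> \<xi>' r
    using busemann_difference_surj[OF cat that] by metis
  have "inj_on \<psi> (?I \<times> ?I \<times> UNIV)"
  proof (rule inj_onI)
    fix x y assume "x \<in> ?I \<times> ?I \<times> UNIV" "y \<in> ?I \<times> ?I \<times> UNIV" and eq: "\<psi> x = \<psi> y"
    then obtain \<xi> \<xi>' r \<eta> \<eta>' s where xy: "x = (\<xi>, \<xi>', r)" "y = (\<eta>, \<eta>', s)"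
      and I: "\<xi> \<in> ?I" "\<xi>' \<in> ?I" "\<eta> \<in> ?I" "\<eta>' \<in> ?I" by blast
    obtain p p' where r: "r = busemann \<xi>' p' b - busemann \<xi> p b'" using surj[OF I(1,2)] by blast
    obtain q q' where s: "s = busemann \<eta>' q' b - busemann \<eta> q b'" using surj[OF I(3,4)] by blast
    have "max_busemann_class \<xi> p \<xi>' p' = max_busemann_class \<eta> q \<eta>' q'"
      using eq unfolding xy r s \<psi>[OF I(1,2)] \<psi>[OF I(3,4)] .
    from max_busemann_class_inj[OF cat I this] show "x = y" unfolding xy r s by simp
  qed
  then have \<phi>\<psi>: "\<phi> (\<psi> y) = y" if "y \<in> ?I \<times> ?I \<times> UNIV" for y
    unfolding \<phi>_def using that by (rule inv_into_f_f)
  have \<phi>: "\<phi> (max_busemann_class \<xi> p \<xi>' p') = (\<xi>, \<xi>', busemann \<xi>' p' b - busemann \<xi> p b')"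
    if "\<xi> \<in> ?I" "\<xi>' \<in> ?I" for \<xi> \<xi>' p p'
    using \<phi>\<psi>[of "(\<xi>, \<xi>', busemann \<xi>' p' b - busemann \<xi> p b')"] \<psi>[OF that] that by simp
  have Y: "topspace ?Y = ?I \<times> ?I \<times> UNIV" using topspace_ideal_boundary[OF cat] by simp
  have "homeomorphic_maps ?X ?Y \<phi> \<psi>"
    unfolding homeomorphic_maps_def
  proof (intro conjI ballI)
    show "continuous_map ?X ?Y \<phi>" by (rule continuous_map_coordinates[OF cat \<phi>])
    have "\<psi> y \<in> max_boundary_reg" if yY: "y \<in> topspace ?Y" for y
    proof -
      obtain \<xi> \<xi>' r where y: "y = (\<xi>, \<xi>', r)" "\<xi> \<in> ?I" "\<xi>' \<in> ?I" using yY unfolding Y by blast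
      then obtain p p' where "r = busemann \<xi>' p' b - busemann \<xi> p b'" using surj by blast
      then show ?thesis using \<psi> y unfolding max_boundary_reg_eq[OF cat] by blast
    qed
    then show "continuous_map ?Y ?X \<psi>"
      using continuous_map_max_busemann[OF cat, of b' b]
      by (auto simp: continuous_map_in_subtopology \<psi>_def)
    show "\<psi> (\<phi> F) = F" if "F \<in> topspace ?X" for F
    proof -
      have "F \<in> max_boundary_reg" using that by simp
      then obtain \<xi> p \<xi>' p' where "F = max_busemann_class \<xi> p \<xi>' p'" "\<xi> \<in> ?I" "\<xi>' \<in> ?I"
        unfolding max_boundary_reg_eq[OF cat] by blast
      then show ?thesis using \<phi> \<psi> by simp
    qed
    show "\<phi> (\<psi> y) = y" if "y \<in> topspace ?Y" for y
      using that \<phi>\<psi> unfolding Y by blast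
  qed
  then have "homeomorphic_map ?X ?Y \<phi>" unfolding homeomorphic_map_maps by blast
  with \<phi> show ?thesis by blast
qed

end
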